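(* Let $N:V\to\mathbb{S}^2$ be an admissible realization of a simply connected triangulated surface $M=(V,E,F)$ whose polar $\hat N:V^*\to\mathbb{R}^3$ with respect to the unit sphere is defined, and suppose $N$ and $\hat N$ are non-degenerate. Given $k:E_{int}\to\mathbb{R}$, the following are equivalent: (1) There exists a C-minimal surface $\tilde f:V^*\to\mathbb{R}^3$ with Gauss map $N$ such that for every interior edge $\{ij\}$, $d\tilde f(e^*_{ij})=k_{ij}\,N_i\times N_j$. (2) The assignment of $k_{ij}\,N_i\times N_j$ to each oriented edge $e^*_{ij}$ defines equal and opposite forces to the neighboring faces along each edge of $\hat N$ that is in equilibrium on every face, i.e. for every dual face $i^*\in F^*_{int}$ $$\sum_j k_{ij}\,N_i\times N_j=0\quad\text{(forces balanced)},\qquad \sum_j k_{ij}\,r_{ij}\times(N_i\times N_j)=0\quad\text{(torques balanced)},$$ where $r_{ij}:=(N_i+N_j)/(1+\langle N_i,N_j\rangle)$, which is a point on the (line spanned by the) image of $\{ij\}^*$ under $\hat N$.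
   Context: A triangulated surface is a cell decomposition $M=(V,E,F)$ of an oriented surface, with or without boundary, all of whose faces are triangles; $V_{int}$ and $E_{int}$ denote the interior vertices and interior edges. $M^*=(V^*,E^*,F^* )$ is the dual cell decomposition: elements of $V^*$ correspond to faces of $M$, each $i\in V$ corresponds to a dual face $i^*\in F^*$, and $F^*_{int}$ is the set of dual faces of interior vertices. $e_{ij}$ is the oriented edge from $i$ to $j$; for an interior edge, $e_{ij}^*$ is the dual edge oriented from the right face $\phi_r$ of $e_{ij}$ to its left face $\phi_l$; for $f$ defined on $V^*$, $df(e^*_{ij})=f_{\phi_l}-f_{\phi_r}$. Sums $\sum_j$ run over the neighbors $j$ of $i$; $k_{ij}=k_{ji}$. A realization is an assignment of positions to vertices; it is non-degenerate if the endpoints of every edge have distinct positions (for $\hat N$: of every dual edge). $N:V\to\mathbb{S}^2$ is admissible if $N_i\neq-N_j$ for every edge $\{ij\}$. The polar plane of $\hat x\in\mathbb{R}^3$ with respect to the unit sphere is $\{y\in\mathbb{R}^3:\langle y,\hat x\rangle=1\}$, and $\hat x$ is the pole of this plane. The polar $\hat N:V^*\to\mathbb{R}^3$ of $N$ assigns to each triangle $\{ijk\}$ the pole of the plane through $N_i,N_j,N_k$, i.e. the point $\hat N_{ijk}$ with $\langle \hat N_{ijk},N_i\rangle=\langle \hat N_{ijk},N_j\rangle=\langle \hat N_{ijk},N_k\rangle=1$ (in particular this plane does not pass through the origin). $\hat N$ has planar faces tangent to the unit sphere with face normal $N$, and the image of $\{ij\}^*$ is parallel to $N_i\times N_j$.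 A realization $\tilde f:V^*\to\mathbb{R}^3$ is C-minimal with Gauss map $N:V\to\mathbb{S}^2$ if $N$ is admissible, $\tilde f$ has planar faces with face normal $N$ (i.e. $N_i$ and $N_j$ are both orthogonal to $d\tilde f(e^*_{ij})$ for every interior edge $\{ij\}$), and the scalar mean curvature $\tilde H_i:=\sum_j |d\tilde f(e^*_{ij})|\tan\frac{\alpha_{ij}}{2}$ vanishes for every $i\in V_{int}$. Here, if $d\tilde f(e^*_{ij})\ne0$, the dihedral angle $\alpha_{ij}\in(-\pi,\pi)$ is determined by $\sin\alpha_{ij}=\langle N_i\times N_j, d\tilde f(e^*_{ij})/|d\tilde f(e^*_{ij})|\rangle$ and $\cos\alpha_{ij}=\langle N_i,N_j\rangle$; if $d\tilde f(e^*_{ij})=0$ the term is $0$. *)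

theory Defs
  imports "HOL-Analysis.Analysis"
begin

text \<open>
  An oriented triangulated surface is a two-dimensional simplicial complex together with the set
  of positively oriented triangles, each written as an ordered triple of vertices in all three of
  its cyclic rotations.
\<close>

record 'v tri_surface =
  verts :: "'v set"
  edges :: "'v set set"
  faces :: "'v set set"
  orient :: "('v \<times> 'v \<times> 'v) set"

definition simplicial_data :: "'v tri_surface \<Rightarrow> bool" where
  "simplicial_data M \<longleftrightarrow>
     (\<forall>f\<in>faces M. card f = 3) \<and>
     verts M = \<Union> (faces M) \<and>
     edges M = {e. card e = 2 \<and> (\<exists>f\<in>faces M. e \<subseteq> f)}"

text \<open>
  The complex is locally a surface with boundary: an edge lies in one or two faces, and the
  link of every vertex is finite and connected.  As the edge condition bounds the degrees in the
  link by two, the link is a cycle (interior vertex) or a path (boundary vertex).  Infinite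
  surfaces are allowed, and no global connectedness is required here.
\<close>

definition locally_surface :: "'v tri_surface \<Rightarrow> bool" where
  "locally_surface M \<longleftrightarrow>
     (\<forall>e\<in>edges M. card {f\<in>faces M. e \<subseteq> f} \<in> {1, 2}) \<and>
     (\<forall>i\<in>verts M. finite {f\<in>faces M. i \<in> f}) \<and>
     (\<forall>i j k. {i, j} \<in> edges M \<longrightarrow> {i, k} \<in> edges M \<longrightarrow>
        (j, k) \<in> {(x, y). {i, x, y} \<in> faces M}\<^sup>*)"

text \<open>
  Every face has exactly one of its two cyclic orders, and two adjacent faces induce opposite
  directions on their common edge.
\<close>

definition coherently_oriented :: "'v tri_surface \<Rightarrow> bool" where
  "coherently_oriented M \<longleftrightarrow>
     (\<forall>i j k. (i, j, k) \<in> orient M \<longrightarrow> {i, j, k} \<in> faces M \<and> (j, k, i) \<in> orient M) \<and>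
     (\<forall>i j k. {i, j, k} \<in> faces M \<longrightarrow> ((i, j, k) \<in> orient M \<longleftrightarrow> (j, i, k) \<notin> orient M)) \<and>
     (\<forall>i j k l. {i, j, k} \<in> faces M \<longrightarrow> {i, j, l} \<in> faces M \<longrightarrow> k \<noteq> l \<longrightarrow>
        ((i, j, k) \<in> orient M \<longleftrightarrow> (j, i, l) \<in> orient M))"

definition triangulated_surface :: "'v tri_surface \<Rightarrow> bool" where
  "triangulated_surface M \<longleftrightarrow>
     simplicial_data M \<and> locally_surface M \<and> coherently_oriented M"

text \<open>
  The underlying space, in barycentric coordinates.  It inherits the product topology of
  \<^typ>\<open>'v \<Rightarrow> real\<close>, which for a locally finite complex agrees with the weak (CW) topology.
\<close>

definition geometric_realization :: "'v tri_surface \<Rightarrow> ('v \<Rightarrow> real) set" where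
  "geometric_realization M =
     {x. \<exists>f\<in>faces M. (\<forall>i. 0 \<le> x i) \<and> (\<forall>i. i \<notin> f \<longrightarrow> x i = 0) \<and> (\<Sum>i\<in>f. x i) = 1}"

definition simply_connected_surface :: "'v tri_surface \<Rightarrow> bool" where
  "simply_connected_surface M \<longleftrightarrow> simply_connected (geometric_realization M)"

definition interior_edges :: "'v tri_surface \<Rightarrow> 'v set set" where
  "interior_edges M = {e\<in>edges M. card {f\<in>faces M. e \<subseteq> f} = 2}"

definition interior_verts :: "'v tri_surface \<Rightarrow> 'v set" where
  "interior_verts M = {i\<in>verts M. \<forall>e\<in>edges M. i \<in> e \<longrightarrow> e \<in> interior_edges M}"

definition neighbors :: "'v tri_surface \<Rightarrow> 'v \<Rightarrow> 'v set" where
  "neighbors M i = {j. {i, j} \<in> edges M}"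

text \<open>
  Vertices of the dual decomposition are the faces of \<open>M\<close>, so maps on them have type
  \<^typ>\<open>'v set \<Rightarrow> 'a\<close>; only their values on faces matter.  The oriented edge from \<open>i\<close> to \<open>j\<close> has
  its left face on the side where \<open>i, j\<close> occur in positive cyclic order.
\<close>

definition left_face :: "'v tri_surface \<Rightarrow> 'v \<Rightarrow> 'v \<Rightarrow> 'v set" where
  "left_face M i j = (THE f. \<exists>k. (i, j, k) \<in> orient M \<and> f = {i, j, k})"

definition right_face :: "'v tri_surface \<Rightarrow> 'v \<Rightarrow> 'v \<Rightarrow> 'v set" where
  "right_face M i j = left_face M j i"

definition dual_diff :: "'v tri_surface \<Rightarrow> ('v set \<Rightarrow> real^3) \<Rightarrow> 'v \<Rightarrow> 'v \<Rightarrow> real^3" where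
  "dual_diff M f i j = f (left_face M i j) - f (right_face M i j)"

definition nondegenerate :: "'v tri_surface \<Rightarrow> ('v \<Rightarrow> real^3) \<Rightarrow> bool" where
  "nondegenerate M N \<longleftrightarrow> (\<forall>i j. {i, j} \<in> edges M \<longrightarrow> N i \<noteq> N j)"

definition dual_nondegenerate :: "'v tri_surface \<Rightarrow> ('v set \<Rightarrow> real^3) \<Rightarrow> bool" where
  "dual_nondegenerate M f \<longleftrightarrow>
     (\<forall>i j. {i, j} \<in> interior_edges M \<longrightarrow> f (left_face M i j) \<noteq> f (right_face M i j))"

definition admissible :: "'v tri_surface \<Rightarrow> ('v \<Rightarrow> real^3) \<Rightarrow> bool" where
  "admissible M N \<longleftrightarrow>
     (\<forall>i\<in>verts M. N i \<in> sphere 0 1) \<and> (\<forall>i j. {i, j} \<in> edges M \<longrightarrow> N i \<noteq> - N j)"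

definition polar_plane :: "real^3 \<Rightarrow> (real^3) set" where
  "polar_plane x = {y. y \<bullet> x = 1}"

text \<open>
  The plane with pole \<open>P f\<close> passes through the images of the three vertices of \<open>f\<close>.
\<close>

definition is_polar :: "'v tri_surface \<Rightarrow> ('v \<Rightarrow> real^3) \<Rightarrow> ('v set \<Rightarrow> real^3) \<Rightarrow> bool" where
  "is_polar M N P \<longleftrightarrow> (\<forall>f\<in>faces M. \<forall>i\<in>f. N i \<in> polar_plane (P f))"

definition planar_faces_with_normal ::
  "'v tri_surface \<Rightarrow> ('v set \<Rightarrow> real^3) \<Rightarrow> ('v \<Rightarrow> real^3) \<Rightarrow> bool" where
  "planar_faces_with_normal M f N \<longleftrightarrow>
     (\<forall>i j. {i, j} \<in> interior_edges M \<longrightarrow>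
        N i \<bullet> dual_diff M f i j = 0 \<and> N j \<bullet> dual_diff M f i j = 0)"

definition dihedral_angle ::
  "'v tri_surface \<Rightarrow> ('v \<Rightarrow> real^3) \<Rightarrow> ('v set \<Rightarrow> real^3) \<Rightarrow> 'v \<Rightarrow> 'v \<Rightarrow> real" where
  "dihedral_angle M N f i j =
     (THE \<alpha>. - pi < \<alpha> \<and> \<alpha> < pi \<and>
        sin \<alpha> = cross3 (N i) (N j) \<bullet> (dual_diff M f i j /\<^sub>R norm (dual_diff M f i j)) \<and>
        cos \<alpha> = N i \<bullet> N j)"

definition mean_curvature ::
  "'v tri_surface \<Rightarrow> ('v \<Rightarrow> real^3) \<Rightarrow> ('v set \<Rightarrow> real^3) \<Rightarrow> 'v \<Rightarrow> real" where
  "mean_curvature M N f i =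
     (\<Sum>j\<in>neighbors M i.
        if dual_diff M f i j = 0 then 0
        else norm (dual_diff M f i j) * tan (dihedral_angle M N f i j / 2))"

definition C_minimal ::
  "'v tri_surface \<Rightarrow> ('v set \<Rightarrow> real^3) \<Rightarrow> ('v \<Rightarrow> real^3) \<Rightarrow> bool" where
  "C_minimal M f N \<longleftrightarrow>
     admissible M N \<and> planar_faces_with_normal M f N \<and>
     (\<forall>i\<in>interior_verts M. mean_curvature M N f i = 0)"

definition edge_point :: "('v \<Rightarrow> real^3) \<Rightarrow> 'v \<Rightarrow> 'v \<Rightarrow> real^3" where
  "edge_point N i j = (N i + N j) /\<^sub>R (1 + N i \<bullet> N j)"

text \<open>
  \<open>F i j\<close> is the force which the dual face of \<open>i\<close> receives along the dual of the edge \<open>{i, j}\<close>,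
  and \<open>r i j\<close> is a point of its line of action; torques are taken about the origin.
\<close>

definition equal_and_opposite :: "'v tri_surface \<Rightarrow> ('v \<Rightarrow> 'v \<Rightarrow> real^3) \<Rightarrow> bool" where
  "equal_and_opposite M F \<longleftrightarrow> (\<forall>i j. {i, j} \<in> interior_edges M \<longrightarrow> F j i = - F i j)"

definition forces_balanced :: "'v tri_surface \<Rightarrow> ('v \<Rightarrow> 'v \<Rightarrow> real^3) \<Rightarrow> 'v \<Rightarrow> bool" where
  "forces_balanced M F i \<longleftrightarrow> (\<Sum>j\<in>neighbors M i. F i j) = 0"

definition torques_balanced ::
  "'v tri_surface \<Rightarrow> ('v \<Rightarrow> 'v \<Rightarrow> real^3) \<Rightarrow> ('v \<Rightarrow> 'v \<Rightarrow> real^3) \<Rightarrow> 'v \<Rightarrow> bool" where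
  "torques_balanced M r F i \<longleftrightarrow> (\<Sum>j\<in>neighbors M i. cross3 (r i j) (F i j)) = 0"

end

theory Submission
  imports Defs
begin

text \<open>
  A C-minimal surface with the given differences is a function on the faces whose difference is
  \<open>\<omega>\<^sub>i\<^sub>j = k\<^sub>i\<^sub>j N\<^sub>i \<times> N\<^sub>j\<close> across the interior edges, with vanishing mean curvature.  Such a function
  is a primitive of the dual 1-cochain \<open>\<omega>\<close>.  The differences of a function sum to zero around
  an interior vertex, and on a simply connected surface the converse holds
  (\<open>dual_closed_imp_exact\<close>).  Hence the primitive exists exactly when the forces balance.

  The torques account for the curvature.  The half-angle formula
  \<open>tan (\<alpha>/2) = sin \<alpha> / (1 + cos \<alpha>)\<close> turns the mean curvature into
  \<open>\<Sum>\<^sub>j k\<^sub>i\<^sub>j (1 - \<langle>N\<^sub>i, N\<^sub>j\<rangle>)\<close> (\<open>norm_times_tan_dihedral_angle\<close>), and a double cross product turns the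
  torque into \<open>T = \<Sum>\<^sub>j k\<^sub>i\<^sub>j (N\<^sub>i - N\<^sub>j)\<close> (\<open>edge_point_torque\<close>).  So the mean curvature is the component
  of \<open>T\<close> along \<open>N\<^sub>i\<close>, while the total force is \<open>- N\<^sub>i \<times> T\<close> and measures the components of \<open>T\<close>
  orthogonal to \<open>N\<^sub>i\<close>.  Therefore \<open>T\<close> vanishes if and only if both the force and the mean
  curvature do (\<open>torque_zero_iff\<close>).

  The forces are equal and opposite because the cross product is skew.  The edge point lies on the
  dual edge because it solves the two equations \<open>\<langle>y, N\<^sub>i\<rangle> = \<langle>y, N\<^sub>j\<rangle> = 1\<close> that cut out the line
  through the two poles (\<open>edge_point_on_polar_line\<close>).

  The topological part has two steps.  Around a vertex \<open>i\<close> the faces form a path or a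
  cycle, so \<open>\<omega>\<close> has a local primitive \<open>g\<^sub>i\<close> on the faces at \<open>i\<close>; on a cycle this is where closedness
  at the interior vertex enters (\<open>local_dual_potential\<close>).  On the faces that contain both \<open>i\<close>
  and \<open>j\<close> the difference \<open>c\<^sub>i\<^sub>j = g\<^sub>i - g\<^sub>j\<close> is constant, so \<open>c\<close> is a closed simplicial 1-cochain, and
  the local primitives can be shifted to agree once \<open>c\<close> is exact.

  Exactness (\<open>closed_cochain_exact\<close>) follows the lifting argument for covering spaces.
  Over the open star of a vertex \<open>i\<close>, a closed cochain has the step function
  \<open>x \<mapsto> c i (support_vertex x)\<close> as a primitive, and the step functions of two stars differ by a
  constant on their intersection.  A lift along a continuous map \<open>h\<close> into the complex
  is a function \<open>\<theta>\<close> that near every point differs from such a step function by a constant.  Lifts exist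
  over every square and are unique up to a constant on connected sets.  Along an edge path a
  lift grows by the sum of \<open>c\<close> over the path; along a constant loop it does not grow at all; and
  a lift over a homotopy of loops shows that homotopic loops have the same growth.  So \<open>c\<close> sums to
  zero over every closed edge path, and summing \<open>c\<close> along edge paths defines a potential.
\<close>

section \<open>Potentials on paths and cycles\<close>

lemma finite_injective_relation_total_imp_onto:
  assumes fin: "finite B" and tot: "\<And>x. x \<in> B \<Longrightarrow> \<exists>y\<in>B. (x, y) \<in> R"
    and inj: "\<And>x y z. (x, z) \<in> R \<Longrightarrow> (y, z) \<in> R \<Longrightarrow> x = y"
    and "y \<in> B"
  shows "\<exists>x\<in>B. (x, y) \<in> R"
proof -
  obtain s where s: "\<And>x. x \<in> B \<Longrightarrow> s x \<in> B \<and> (x, s x) \<in> R"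
    using tot by metis
  then have "inj_on s B" "s ` B \<subseteq> B"
    using inj by (metis inj_onI, blast)
  then have "s ` B = B" using endo_inj_surj fin by blast
  then show ?thesis using s \<open>y \<in> B\<close> by (metis imageE)
qed

text \<open>
  The forward orbit of \<open>a\<close> contains the predecessor of each of its points other than \<open>a\<close>, since
  predecessors are unique.  Either \<open>a\<close> has no predecessor, or the relation is total on the finite orbit
  and a counting argument finds the predecessor of \<open>a\<close> there.  So the orbit is a connected component.
\<close>

lemma reach_in_connected_injective_relation:
  fixes R :: "'a rel"
  assumes fin: "finite A" and RA: "R \<subseteq> A \<times> A"
    and inj: "\<And>x y z. (x, z) \<in> R \<Longrightarrow> (y, z) \<in> R \<Longrightarrow> x = y"
    and conn: "\<And>x y. x \<in> A \<Longrightarrow> y \<in> A \<Longrightarrow> (x, y) \<in> (R \<union> R\<inverse>)\<^sup>*"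
    and start: "a \<in> A" "(\<forall>x. (x, a) \<notin> R) \<or> (\<forall>x\<in>A. \<exists>y. (x, y) \<in> R)"
    and y: "y \<in> A"
  shows "(a, y) \<in> R\<^sup>*"
proof -
  define B where "B = R\<^sup>* `` {a}"
  have BA: "B \<subseteq> A"
  proof
    fix x assume "x \<in> B"
    then have "(a, x) \<in> R\<^sup>*" by (simp add: B_def)
    then show "x \<in> A" by (induction) (use RA start(1) in auto)
  qed
  then have fB: "finite B" using fin finite_subset by blast
  have fwd: "z \<in> B" if "x \<in> B" "(x, z) \<in> R" for x z
    using that by (auto simp: B_def)
  have has_pred: "\<exists>x\<in>B. (x, a) \<in> R" if tot: "\<forall>x\<in>A. \<exists>y. (x, y) \<in> R"
  proof (rule finite_injective_relation_total_imp_onto[OF fB _ inj])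
    show "\<exists>y\<in>B. (x, y) \<in> R" if "x \<in> B" for x
      using tot BA fwd that by blast
    show "a \<in> B" by (simp add: B_def)
  qed
  have bwd: "x \<in> B" if "z \<in> B" "(x, z) \<in> R" for x z
  proof (cases "z = a")
    case True
    then show ?thesis using start(2) has_pred inj that(2) by metis
  next
    case False
    with \<open>z \<in> B\<close> obtain x' where "(a, x') \<in> R\<^sup>*" "(x', z) \<in> R"
      unfolding B_def by (auto elim: rtranclE)
    then show ?thesis using inj that(2) by (auto simp: B_def)
  qed
  have "(a, y) \<in> (R \<union> R\<inverse>)\<^sup>*" using conn start(1) y by blast
  then have "y \<in> B"
  proof (induction)
    case base
    show ?case by (simp add: B_def)
  next
    case (step u v)
    then show ?case using fwd bwd by blast
  qed
  then show ?thesis by (simp add: B_def)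
qed

text \<open>
  A connected relation with at most one successor and one predecessor per point is a path or a cycle.
  Counting steps from a starting point orders the points along the path or cycle, and the
  potential is the sum of the weights up to a point.  On a cycle the last step returns to the
  start, and there the increments match because the total weight is zero.
\<close>

lemma potential_on_path_or_cycle:
  fixes R :: "'a rel" and w :: "'a \<Rightarrow> 'b::ab_group_add"
  assumes fin: "finite A" and RA: "R \<subseteq> A \<times> A"
    and func: "\<And>x y z. (x, y) \<in> R \<Longrightarrow> (x, z) \<in> R \<Longrightarrow> y = z"
    and inj: "\<And>x y z. (x, z) \<in> R \<Longrightarrow> (y, z) \<in> R \<Longrightarrow> x = y"
    and conn: "\<And>x y. x \<in> A \<Longrightarrow> y \<in> A \<Longrightarrow> (x, y) \<in> (R \<union> R\<inverse>)\<^sup>*"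
    and closed: "(\<And>x. x \<in> A \<Longrightarrow> \<exists>y. (x, y) \<in> R) \<Longrightarrow> sum w A = 0"
  obtains G where "\<And>x y. (x, y) \<in> R \<Longrightarrow> G y = G x + w y"
proof (cases "A = {}")
  case True
  with RA have "R = {}" by blast
  then show ?thesis using that[of "\<lambda>_. 0"] by simp
next
  case False
  \<comment> \<open>The right disjunct covers the cycle: there every point has a predecessor, so by finiteness also a successor.\<close>
  have ex_start: "\<exists>a\<in>A. (\<forall>x. (x, a) \<notin> R) \<or> (\<forall>x\<in>A. \<exists>y. (x, y) \<in> R)"
  proof (cases "\<forall>a\<in>A. \<exists>x. (x, a) \<in> R")
    case True
    have "\<forall>x\<in>A. \<exists>y\<in>A. (y, x) \<in> R\<inverse>"
      using finite_injective_relation_total_imp_onto[OF fin, of "R\<inverse>"] True RA func by blast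
    then show ?thesis using False by blast
  qed blast
  then obtain a where a: "a \<in> A" "(\<forall>x. (x, a) \<notin> R) \<or> (\<forall>x\<in>A. \<exists>y. (x, y) \<in> R)" by blast
  define n where "n x = (LEAST n. (a, x) \<in> R ^^ n)" for x
  have reach: "(a, x) \<in> R ^^ n x" if "x \<in> A" for x
  proof -
    have "(a, x) \<in> R\<^sup>*"
      by (rule reach_in_connected_injective_relation[OF fin RA inj conn a that])
    then obtain m where "(a, x) \<in> R ^^ m" using rtrancl_imp_relpow by blast
    then show ?thesis unfolding n_def by (rule LeastI)
  qed
  have n_le: "n x \<le> m" if "(a, x) \<in> R ^^ m" for x m
    unfolding n_def using that by (rule Least_le)
  have det: "x = y" if "(a, x) \<in> R ^^ m" "(a, y) \<in> R ^^ m" for m x y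
    using that
  proof (induction m arbitrary: x y)
    case (Suc m)
    then obtain x' y' where "(a, x') \<in> R ^^ m" "(x', x) \<in> R" "(a, y') \<in> R ^^ m" "(y', y) \<in> R"
      by (meson relpow_Suc_E)
    then show ?case using Suc.IH func by metis
  qed auto
  have n_inj: "x = y" if "x \<in> A" "y \<in> A" "n x = n y" for x y
    using det reach that by metis
  have n_a: "n a = 0" using n_le[of a 0] by simp
  have n_Suc: "n y = Suc (n x)" if R: "(x, y) \<in> R" and "y \<noteq> a" for x y
  proof -
    have xy: "x \<in> A" "y \<in> A" using R RA by auto
    have "n y \<le> Suc (n x)"
      using n_le reach[OF xy(1)] R by (metis relpow_Suc_I)
    moreover obtain m where m: "n y = Suc m"
      using reach[OF xy(2)] \<open>y \<noteq> a\<close> by (cases "n y") auto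
    have "(a, x) \<in> R ^^ m"
      using reach[OF xy(2)] inj R unfolding m by (auto elim!: relpow_Suc_E)
    then have "n x \<le> m" by (rule n_le)
    ultimately show ?thesis using m by simp
  qed
  \<comment> \<open>The weight of \<open>a\<close> is included in every sum, so that the cycle closes up with the full sum over \<open>A\<close>.\<close>
  define G where "G x = sum w {z\<in>A. n z \<le> n x}" for x
  have "G y = G x + w y" if R: "(x, y) \<in> R" for x y
  proof (cases "y = a")
    case False
    have y: "y \<in> A" using R RA by auto
    have "{z\<in>A. n z \<le> n y} = insert y {z\<in>A. n z \<le> n x}"
      using n_Suc[OF R False] n_inj y by (auto simp: le_Suc_eq)
    then show ?thesis
      using n_Suc[OF R False] fin by (simp add: G_def add.commute)
  next
    case True
    have x: "x \<in> A" using R RA by auto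
    have tot: "\<forall>x\<in>A. \<exists>y. (x, y) \<in> R" using a(2) R True by blast
    have max: "n z \<le> n x" if "z \<in> A" for z
    proof -
      have "(a, z) \<in> R\<^sup>*" by (rule reach_in_connected_injective_relation[OF fin RA inj conn a that])
      then show ?thesis
      proof (induction)
        case base then show ?case by (simp add: n_a)
      next
        case (step u v)
        show ?case
        proof (cases "v = a")
          case False
          have "u \<in> A" using step RA by auto
          have "u \<noteq> x" using False func R True step(2) by blast
          then have "n u \<noteq> n x" using n_inj \<open>u \<in> A\<close> x by blast
          then show ?thesis using n_Suc[OF step(2) False] step(3) by simp
        qed (simp add: n_a)
      qed
    qed
    have "{z\<in>A. n z \<le> n x} = A" using max by blast
    moreover have "{z\<in>A. n z \<le> n a} = {a}" using n_a n_inj a(1) by auto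
    ultimately show ?thesis using closed tot True by (simp add: G_def)
  qed
  then show ?thesis by (rule that)
qed

section \<open>Closed cochains on a simply connected complex\<close>

text \<open>
  A choice of a vertex of the carrier simplex.  At a given point, another choice shifts the step
  functions \<open>x \<mapsto> c i (support_vertex x)\<close> of all stars containing it by the same amount.
\<close>

definition support_vertex :: "('v \<Rightarrow> real) \<Rightarrow> 'v" where
  "support_vertex x = (SOME i. 0 < x i)"

text \<open>
  The condition on \<open>\<theta>\<close> is that of a section of the pulled-back covering with fibre \<^typ>\<open>'b\<close>:
  wherever \<open>h\<close> meets the open star of \<open>i\<close>, the function \<open>\<theta>\<close> is locally a constant plus the step function
  of \<open>i\<close>.  The function \<open>\<theta>\<close> itself jumps together with \<open>support_vertex\<close>.
\<close>

definition cochain_lift ::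
  "('v \<Rightarrow> 'v \<Rightarrow> 'b::ab_group_add) \<Rightarrow> ('a::topological_space \<Rightarrow> 'v \<Rightarrow> real) \<Rightarrow> 'a set \<Rightarrow> ('a \<Rightarrow> 'b) \<Rightarrow> bool"
  where "cochain_lift c h S \<theta> \<longleftrightarrow>
     (\<forall>z\<in>S. \<forall>i. 0 < h z i \<longrightarrow> (\<exists>U. open U \<and> z \<in> U \<and>
        (\<forall>w\<in>S \<inter> U. \<theta> w - c i (support_vertex (h w)) = \<theta> z - c i (support_vertex (h z)))))"

text \<open>
  The vertices may coincide, so that the identity contains \<open>c i i = 0\<close> and antisymmetry.
\<close>

definition cochain_closed :: "'v tri_surface \<Rightarrow> ('v \<Rightarrow> 'v \<Rightarrow> 'b::ab_group_add) \<Rightarrow> bool" where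
  "cochain_closed M c \<longleftrightarrow> (\<forall>f\<in>faces M. \<forall>i\<in>f. \<forall>j\<in>f. \<forall>k\<in>f. c i j + c j k = c i k)"

lemma cochain_closedD:
  "cochain_closed M c \<Longrightarrow> f \<in> faces M \<Longrightarrow> i \<in> f \<Longrightarrow> j \<in> f \<Longrightarrow> k \<in> f \<Longrightarrow> c i j + c j k = c i k"
  by (simp add: cochain_closed_def)

lemma cochain_closed_refl: "cochain_closed M c \<Longrightarrow> f \<in> faces M \<Longrightarrow> i \<in> f \<Longrightarrow> c i i = 0"
  using cochain_closedD[of M c f i i i] by simp

lemma cochain_closed_swap:
  "cochain_closed M c \<Longrightarrow> f \<in> faces M \<Longrightarrow> i \<in> f \<Longrightarrow> j \<in> f \<Longrightarrow> c j i = - c i j"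
  using cochain_closedD[of M c f i j i] cochain_closed_refl[of M c f i]
  by (simp add: eq_neg_iff_add_eq_0 add.commute)

lemma realization_positive_coordinate:
  assumes "x \<in> geometric_realization M"
  shows "\<exists>i. 0 < x i"
proof -
  obtain f where f: "\<forall>i. 0 \<le> x i" "(\<Sum>i\<in>f. x i) = 1"
    using assms by (auto simp: geometric_realization_def)
  have "\<exists>i\<in>f. x i \<noteq> 0"
    using f(2) by (metis sum.neutral zero_neq_one)
  then show ?thesis using f(1) by (metis order_le_less)
qed

lemma support_vertex_pos:
  "x \<in> geometric_realization M \<Longrightarrow> 0 < x (support_vertex x)"
  unfolding support_vertex_def by (rule someI_ex[OF realization_positive_coordinate])

lemma support_in_face:
  assumes "x \<in> geometric_realization M"
  obtains f where "f \<in> faces M" "\<And>i. 0 < x i \<Longrightarrow> i \<in> f"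
  using assms unfolding geometric_realization_def by force

text \<open>
  Two vertices of the support of \<open>x\<close> lie in a common face with \<open>support_vertex x\<close>, so the cocycle
  identity on that face applies.  Hence the step functions of two stars differ by a constant on
  the intersection of the stars.
\<close>

lemma cochain_change_center:
  assumes c: "cochain_closed M c" and x: "x \<in> geometric_realization M"
    and "0 < x i" "0 < x j"
  shows "c j (support_vertex x) = c j i + c i (support_vertex x)"
proof -
  obtain f where f: "f \<in> faces M" "\<And>i. 0 < x i \<Longrightarrow> i \<in> f"
    using support_in_face[OF x] by blast
  show ?thesis
    using cochain_closedD[OF c f(1), of j i "support_vertex x"] f(2) assms(3,4) support_vertex_pos[OF x]
    by simp
qed

lemma cochain_lift_compose:
  assumes "cochain_lift c h S \<theta>" "continuous_on T g" "g ` T \<subseteq> S"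
  shows "cochain_lift c (\<lambda>z. h (g z)) T (\<lambda>z. \<theta> (g z))"
  unfolding cochain_lift_def
proof (intro ballI allI impI)
  fix z i assume z: "z \<in> T" "0 < h (g z) i"
  then obtain U where U: "open U" "g z \<in> U"
    "\<forall>w\<in>S \<inter> U. \<theta> w - c i (support_vertex (h w)) = \<theta> (g z) - c i (support_vertex (h (g z)))"
    using assms(1,3) unfolding cochain_lift_def by (metis image_subset_iff)
  obtain A where A: "open A" "A \<inter> T = g -` U \<inter> T"
    using assms(2) U(1) unfolding continuous_on_open_invariant by blast
  show "\<exists>U. open U \<and> z \<in> U \<and> (\<forall>w\<in>T \<inter> U. \<theta> (g w) - c i (support_vertex (h (g w)))
           = \<theta> (g z) - c i (support_vertex (h (g z))))"
  proof (intro exI[of _ A] conjI ballI)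
    show "z \<in> A" using A(2) z(1) U(2) by blast
    fix w assume "w \<in> T \<inter> A"
    then have "g w \<in> S \<inter> U" using A(2) assms(3) by blast
    then show "\<theta> (g w) - c i (support_vertex (h (g w))) = \<theta> (g z) - c i (support_vertex (h (g z)))"
      using U(3) by blast
  qed (rule A(1))
qed

lemma cochain_lift_subset:
  "cochain_lift c h S \<theta> \<Longrightarrow> T \<subseteq> S \<Longrightarrow> cochain_lift c h T \<theta>"
  using cochain_lift_compose[of c h S \<theta> T "\<lambda>z. z"] by (simp add: continuous_on_id)

lemma cochain_lift_cong:
  assumes "cochain_lift c h S \<theta>" "\<And>z. z \<in> S \<Longrightarrow> h z = h' z" "\<And>z. z \<in> S \<Longrightarrow> \<theta> z = \<theta>' z"
  shows "cochain_lift c h' S \<theta>'"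
  using assms(1) unfolding cochain_lift_def by (auto simp: assms(2,3)[symmetric])

lemma cochain_lift_shift:
  "cochain_lift c h S \<theta> \<Longrightarrow> cochain_lift c h S (\<lambda>z. \<theta> z + d)"
  unfolding cochain_lift_def by (simp add: add_diff_eq diff_add_eq[symmetric])

lemma locally_constant_on_connected:
  assumes "connected S" "a \<in> S" "b \<in> S"
    and "\<And>z. z \<in> S \<Longrightarrow> \<exists>U. open U \<and> z \<in> U \<and> (\<forall>w\<in>S \<inter> U. f w = f z)"
  shows "f a = f b"
proof (rule connected_local_const[OF assms(1-3)], intro ballI)
  fix z assume "z \<in> S"
  then show "\<forall>\<^sub>F w in at z within S. f z = f w"
    using assms(4) unfolding eventually_at_topological by (metis IntI)
qed

text \<open>
  Two lifts differ from the same step functions by local constants, so their difference is locally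
  constant.
\<close>

lemma cochain_lift_unique:
  assumes "cochain_lift c h S \<theta>\<^sub>1" "cochain_lift c h S \<theta>\<^sub>2" "connected S"
    and pos: "\<And>z. z \<in> S \<Longrightarrow> \<exists>i. 0 < h z i"
    and "a \<in> S" "b \<in> S"
  shows "\<theta>\<^sub>1 a - \<theta>\<^sub>2 a = \<theta>\<^sub>1 b - \<theta>\<^sub>2 b"
proof (rule locally_constant_on_connected[OF assms(3,5,6)])
  fix z assume z: "z \<in> S"
  then obtain i where i: "0 < h z i" using pos by blast
  let ?g = "\<lambda>w. c i (support_vertex (h w))"
  obtain U where U: "open U" "z \<in> U" "\<forall>w\<in>S \<inter> U. \<theta>\<^sub>1 w - ?g w = \<theta>\<^sub>1 z - ?g z"
    using assms(1) z i unfolding cochain_lift_def by blast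
  obtain V where V: "open V" "z \<in> V" "\<forall>w\<in>S \<inter> V. \<theta>\<^sub>2 w - ?g w = \<theta>\<^sub>2 z - ?g z"
    using assms(2) z i unfolding cochain_lift_def by blast
  show "\<exists>U. open U \<and> z \<in> U \<and> (\<forall>w\<in>S \<inter> U. \<theta>\<^sub>1 w - \<theta>\<^sub>2 w = \<theta>\<^sub>1 z - \<theta>\<^sub>2 z)"
  proof (intro exI[of _ "U \<inter> V"] conjI ballI)
    fix w assume "w \<in> S \<inter> (U \<inter> V)"
    then have "\<theta>\<^sub>1 w - ?g w = \<theta>\<^sub>1 z - ?g z" "\<theta>\<^sub>2 w - ?g w = \<theta>\<^sub>2 z - ?g z" using U V by auto
    then show "\<theta>\<^sub>1 w - \<theta>\<^sub>2 w = \<theta>\<^sub>1 z - \<theta>\<^sub>2 z"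
      by (metis diff_add_cancel diff_diff_eq2)
  qed (use U V in auto)
qed

lemma cochain_lift_in_star:
  assumes c: "cochain_closed M c" and h: "continuous_on S h" "h ` S \<subseteq> geometric_realization M"
    and i: "\<And>z. z \<in> S \<Longrightarrow> 0 < h z i"
  shows "cochain_lift c h S (\<lambda>z. c i (support_vertex (h z)))"
  unfolding cochain_lift_def
proof (intro ballI allI impI)
  fix z j assume z: "z \<in> S" "0 < h z j"
  have "continuous_on S (\<lambda>z. h z j)"
    using h(1) by (rule continuous_on_product_then_coordinatewise)
  then obtain A where A: "open A" "A \<inter> S = (\<lambda>z. h z j) -` {0<..} \<inter> S"
    unfolding continuous_on_open_invariant using open_greaterThan by blast
  have eq: "c j (support_vertex (h w)) = c j i + c i (support_vertex (h w))" if "w \<in> S \<inter> A" for w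
  proof (rule cochain_change_center[OF c])
    show "h w \<in> geometric_realization M" "0 < h w i" using h(2) i that by auto
    show "0 < h w j" using A(2) that by auto
  qed
  show "\<exists>U. open U \<and> z \<in> U \<and> (\<forall>w\<in>S \<inter> U. c i (support_vertex (h w)) - c j (support_vertex (h w))
           = c i (support_vertex (h z)) - c j (support_vertex (h z)))"
  proof (intro exI[of _ A] conjI ballI)
    show zA: "z \<in> A" using A(2) z by auto
    fix w assume "w \<in> S \<inter> A"
    then show "c i (support_vertex (h w)) - c j (support_vertex (h w))
           = c i (support_vertex (h z)) - c j (support_vertex (h z))"
      using eq[of w] eq[of z] zA z(1) by simp
  qed (rule A(1))
qed

text \<open>
  On the connected overlap the two lifts differ by a constant; after shifting one of them by it
  they agree there and together give a lift on the union.
\<close>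

lemma cochain_lift_glue:
  assumes 1: "cochain_lift c h S \<theta>\<^sub>1" and 2: "cochain_lift c h T \<theta>\<^sub>2"
    and cl: "closed S" "closed T" and conn: "connected (S \<inter> T)"
    and pos: "\<And>z. z \<in> S \<inter> T \<Longrightarrow> \<exists>i. 0 < h z i"
  shows "\<exists>\<theta>. cochain_lift c h (S \<union> T) \<theta>"
proof -
  have "\<exists>d. \<forall>z\<in>S \<inter> T. \<theta>\<^sub>1 z = \<theta>\<^sub>2 z + d"
  proof (cases "S \<inter> T = {}")
    case False
    then obtain a where a: "a \<in> S \<inter> T" by blast
    have "\<theta>\<^sub>1 z - \<theta>\<^sub>2 z = \<theta>\<^sub>1 a - \<theta>\<^sub>2 a" if "z \<in> S \<inter> T" for z
      using cochain_lift_unique[OF cochain_lift_subset[OF 1] cochain_lift_subset[OF 2] conn pos that a]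
      by blast
    then show ?thesis by (metis add.commute diff_add_cancel)
  qed blast
  then obtain d where d: "\<And>z. z \<in> S \<inter> T \<Longrightarrow> \<theta>\<^sub>1 z = \<theta>\<^sub>2 z + d" by blast
  define \<theta> where "\<theta> z = (if z \<in> S then \<theta>\<^sub>1 z else \<theta>\<^sub>2 z + d)" for z
  have S: "cochain_lift c h S \<theta>"
    using cochain_lift_cong[OF 1, of h \<theta>] by (simp add: \<theta>_def)
  have T: "cochain_lift c h T \<theta>"
    using cochain_lift_cong[OF cochain_lift_shift[OF 2, of d], of h \<theta>] d by (simp add: \<theta>_def)
  have "cochain_lift c h (S \<union> T) \<theta>"
    unfolding cochain_lift_def
  proof (intro ballI allI impI)
    fix z i assume z: "z \<in> S \<union> T" "0 < h z i"
    let ?g = "\<lambda>w. c i (support_vertex (h w))"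
    have loc: "\<exists>U. open U \<and> z \<in> U \<and> (\<forall>w\<in>A \<inter> U. \<theta> w - ?g w = \<theta> z - ?g z)"
      if A: "cochain_lift c h A \<theta>" "closed A" for A
    proof (cases "z \<in> A")
      case True
      then show ?thesis using A(1) z(2) unfolding cochain_lift_def by blast
    next
      case False
      then show ?thesis using A(2) by (intro exI[of _ "- A"]) auto
    qed
    obtain U V where "open U" "z \<in> U" "\<forall>w\<in>S \<inter> U. \<theta> w - ?g w = \<theta> z - ?g z"
      "open V" "z \<in> V" "\<forall>w\<in>T \<inter> V. \<theta> w - ?g w = \<theta> z - ?g z"
      using loc[OF S cl(1)] loc[OF T cl(2)] by blast
    then show "\<exists>U. open U \<and> z \<in> U \<and> (\<forall>w\<in>(S \<union> T) \<inter> U. \<theta> w - ?g w = \<theta> z - ?g z)"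
      by (intro exI[of _ "U \<inter> V"]) auto
  qed
  then show ?thesis by blast
qed

lemma cochain_lift_locally:
  fixes h :: "real \<times> real \<Rightarrow> 'v \<Rightarrow> real"
  assumes c: "cochain_closed M c" and K: "closed K"
    and h: "continuous_on K h" "h ` K \<subseteq> geometric_realization M"
  obtains d where "0 < d" "\<And>S. S \<subseteq> K \<inter> ball z d \<Longrightarrow> \<exists>\<theta>. cochain_lift c h S \<theta>"
proof (cases "z \<in> K")
  case False
  then obtain d where d: "0 < d" "ball z d \<subseteq> - K"
    using K by (metis ComplI open_Compl open_contains_ball)
  have "\<exists>\<theta>. cochain_lift c h S \<theta>" if "S \<subseteq> K \<inter> ball z d" for S
  proof -
    have "S = {}" using that d(2) by blast
    then show ?thesis by (simp add: cochain_lift_def)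
  qed
  then show ?thesis using that d(1) by blast
next
  case True
  then obtain i where i: "0 < h z i"
    using realization_positive_coordinate h(2) by blast
  have "continuous_on K (\<lambda>z. h z i)"
    using h(1) by (rule continuous_on_product_then_coordinatewise)
  then obtain A where A: "open A" "A \<inter> K = (\<lambda>z. h z i) -` {0<..} \<inter> K"
    unfolding continuous_on_open_invariant using open_greaterThan by blast
  then have "z \<in> A" using True i by auto
  then obtain d where d: "0 < d" "ball z d \<subseteq> A"
    using A(1) open_contains_ball by blast
  have "\<exists>\<theta>. cochain_lift c h S \<theta>" if S: "S \<subseteq> K \<inter> ball z d" for S
  proof -
    have "0 < h w i" if "w \<in> S" for w
    proof -
      have "w \<in> A \<inter> K" using that S d(2) by blast
      then show ?thesis unfolding A(2) by simp
    qed
    moreover have "continuous_on S h" "h ` S \<subseteq> geometric_realization M"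
      using h S continuous_on_subset by blast+
    ultimately show ?thesis using cochain_lift_in_star[OF c] by blast
  qed
  then show ?thesis using that d(1) by blast
qed

text \<open>
  Lifts exist on small rectangles and can be glued along a common side, which is convex and thus
  connected.  Bisecting first the vertical and then the horizontal side reaches the whole square.
\<close>

lemma cochain_lift_rectangle:
  fixes h :: "real \<times> real \<Rightarrow> 'v \<Rightarrow> real"
  assumes c: "cochain_closed M c"
    and h: "continuous_on ({0..1} \<times> {0..1}) h" "h ` ({0..1} \<times> {0..1}) \<subseteq> geometric_realization M"
  obtains \<theta> where "cochain_lift c h ({0..1} \<times> {0..1}) \<theta>"
proof -
  define K :: "(real \<times> real) set" where "K = {0..1} \<times> {0..1}"
  define L where "L A B \<longleftrightarrow> (\<exists>\<theta>. cochain_lift c h (K \<inter> A \<times> B) \<theta>)" for A B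
  have K: "closed K" "convex K"
    by (auto simp: K_def intro: closed_Times convex_Times)
  have hK: "continuous_on K h" "h ` K \<subseteq> geometric_realization M"
    using h by (simp_all add: K_def)
  have L_mono: "L A' B'" if "L A B" "A' \<subseteq> A" "B' \<subseteq> B" for A B A' B'
  proof -
    have "K \<inter> A' \<times> B' \<subseteq> K \<inter> A \<times> B" using that by blast
    then show ?thesis using that(1) cochain_lift_subset unfolding L_def by blast
  qed
  have L_glue: "\<exists>\<theta>. cochain_lift c h (K \<inter> (P \<union> Q)) \<theta>"
    if "cochain_lift c h (K \<inter> P) \<theta>\<^sub>1" "cochain_lift c h (K \<inter> Q) \<theta>\<^sub>2" "closed P" "closed Q" "convex (P \<inter> Q)"
    for P Q \<theta>\<^sub>1 \<theta>\<^sub>2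
  proof -
    have "K \<inter> P \<inter> (K \<inter> Q) = K \<inter> (P \<inter> Q)" by blast
    then have "connected (K \<inter> P \<inter> (K \<inter> Q))"
      using K(2) that(5) by (simp add: convex_Int convex_connected)
    moreover have "\<exists>i. 0 < h z i" if "z \<in> K \<inter> P \<inter> (K \<inter> Q)" for z
      using that hK(2) realization_positive_coordinate by blast
    ultimately show ?thesis
      using cochain_lift_glue[OF that(1,2)] K(1) that(3,4) by (simp add: closed_Int Int_Un_distrib)
  qed
  \<comment> \<open>The width \<open>e\<close> may shrink with each gluing, but bisection glues only finitely many pieces.\<close>
  have column: "\<exists>e>0. L {s-e..s+e} {0..1}" for s
  proof (rule Bolzano[of 0 1 "\<lambda>t\<^sub>1 t\<^sub>2. \<exists>e>0. L {s-e..s+e} {t\<^sub>1..t\<^sub>2}"])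
    show "(0::real) \<le> 1" by simp
  next
    fix t\<^sub>1 t\<^sub>2 t\<^sub>3 :: real
    assume t: "t\<^sub>1 \<le> t\<^sub>2" "t\<^sub>2 \<le> t\<^sub>3"
    assume "\<exists>e>0. L {s-e..s+e} {t\<^sub>1..t\<^sub>2}" "\<exists>e>0. L {s-e..s+e} {t\<^sub>2..t\<^sub>3}"
    then obtain e e' where e: "e > 0" "e' > 0" "L {s-e..s+e} {t\<^sub>1..t\<^sub>2}" "L {s-e'..s+e'} {t\<^sub>2..t\<^sub>3}"
      by blast
    define I where "I = {s - min e e'..s + min e e'}"
    have "L I {t\<^sub>1..t\<^sub>2}" "L I {t\<^sub>2..t\<^sub>3}"
      using L_mono[OF e(3), of I] L_mono[OF e(4), of I] by (auto simp: I_def)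
    moreover have "I \<times> {t\<^sub>1..t\<^sub>2} \<inter> I \<times> {t\<^sub>2..t\<^sub>3} = I \<times> {t\<^sub>2..t\<^sub>2}"
      "I \<times> {t\<^sub>1..t\<^sub>2} \<union> I \<times> {t\<^sub>2..t\<^sub>3} = I \<times> {t\<^sub>1..t\<^sub>3}"
      using t by auto
    moreover have "closed (I \<times> {a..b})" "convex (I \<times> {a..b})" for a b :: real
      by (auto simp: I_def intro: closed_Times convex_Times)
    ultimately have "L I {t\<^sub>1..t\<^sub>3}"
      using L_glue[of "I \<times> {t\<^sub>1..t\<^sub>2}" _ "I \<times> {t\<^sub>2..t\<^sub>3}"] unfolding L_def by metis
    then show "\<exists>e>0. L {s-e..s+e} {t\<^sub>1..t\<^sub>3}"
      unfolding I_def using e(1,2) by (metis min_less_iff_conj)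
  next
    fix t :: real
    obtain d where d: "0 < d" "\<And>S. S \<subseteq> K \<inter> ball (s, t) d \<Longrightarrow> \<exists>\<theta>. cochain_lift c h S \<theta>"
      using cochain_lift_locally[OF c K(1) hK, of "(s, t)"] by blast
    show "\<exists>\<delta>>0. \<forall>a b. a \<le> t \<and> t \<le> b \<and> b - a < \<delta> \<longrightarrow> (\<exists>e>0. L {s-e..s+e} {a..b})"
    proof (rule exI[of _ "d/2"], rule conjI, goal_cases)
      case 1
      show ?case using d(1) by simp
    next
      case 2
      show ?case
      proof (intro allI impI)
        fix a b assume ab: "a \<le> t \<and> t \<le> b \<and> b - a < d/2"
        have "{s-d/3..s+d/3} \<times> {a..b} \<subseteq> ball (s, t) d"
        proof (clarify)
          fix x y assume xy: "x \<in> {s-d/3..s+d/3}" "y \<in> {a..b}"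
          have "dist (s, t) (x, y) \<le> \<bar>s - x\<bar> + \<bar>t - y\<bar>"
            using sqrt_sum_squares_le_sum_abs[of "s - x" "t - y"] by (simp add: dist_Pair_Pair dist_real_def)
          also have "\<dots> < d" using xy ab d(1) by (auto simp: abs_if)
          finally show "(x, y) \<in> ball (s, t) d" by simp
        qed
        then have "L {s-d/3..s+d/3} {a..b}" unfolding L_def using d(2) by (meson Int_mono order_refl)
        then show "\<exists>e>0. L {s-e..s+e} {a..b}" using d(1) by (intro exI[of _ "d/3"]) simp
      qed
    qed
  qed
  have "L {0..1} {0..1}"
  proof (rule Bolzano[of 0 1 "\<lambda>s\<^sub>1 s\<^sub>2. L {s\<^sub>1..s\<^sub>2} {0..1}"])
    show "(0::real) \<le> 1" by simp
  next
    fix s\<^sub>1 s\<^sub>2 s\<^sub>3 :: real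
    assume s: "s\<^sub>1 \<le> s\<^sub>2" "s\<^sub>2 \<le> s\<^sub>3" and "L {s\<^sub>1..s\<^sub>2} {0..1}" "L {s\<^sub>2..s\<^sub>3} {0..1}"
    moreover have "{s\<^sub>1..s\<^sub>2} \<times> {0..1} \<inter> {s\<^sub>2..s\<^sub>3} \<times> {0..1} = {s\<^sub>2..s\<^sub>2} \<times> {0..1::real}"
      "{s\<^sub>1..s\<^sub>2} \<times> {0..1} \<union> {s\<^sub>2..s\<^sub>3} \<times> {0..1} = {s\<^sub>1..s\<^sub>3} \<times> {0..1::real}"
      using s by auto
    moreover have "closed ({a..b} \<times> {0..1::real})" "convex ({a..b} \<times> {0..1::real})" for a b :: real
      by (auto intro: closed_Times convex_Times)
    ultimately show "L {s\<^sub>1..s\<^sub>3} {0..1}"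
      using L_glue[of "{s\<^sub>1..s\<^sub>2} \<times> {0..1}" _ "{s\<^sub>2..s\<^sub>3} \<times> {0..1}"] unfolding L_def by metis
  next
    fix s :: real
    obtain e where e: "e > 0" "L {s-e..s+e} {0..1}" using column by blast
    show "\<exists>d>0. \<forall>a b. a \<le> s \<and> s \<le> b \<and> b - a < d \<longrightarrow> L {a..b} {0..1}"
      by (intro exI[of _ e] conjI e(1) allI impI L_mono[OF e(2)]) auto
  qed
  then show ?thesis using that unfolding L_def K_def by auto
qed

definition vertex_point :: "'v \<Rightarrow> 'v \<Rightarrow> real" where
  "vertex_point i = (\<lambda>k. if k = i then 1 else 0)"

lemma support_vertex_point [simp]: "support_vertex (vertex_point i) = i"
  unfolding support_vertex_def vertex_point_def by (rule some_equality) (auto split: if_splits)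

text \<open>
  The straight segment between two vertices, in barycentric coordinates.
\<close>

definition edge_path :: "'v \<Rightarrow> 'v \<Rightarrow> real \<Rightarrow> 'v \<Rightarrow> real" where
  "edge_path i j t = (\<lambda>k. (1 - t) * vertex_point i k + t * vertex_point j k)"

lemma edge_path_ends [simp]: "edge_path i j 0 = vertex_point i" "edge_path i j 1 = vertex_point j"
  by (auto simp: edge_path_def)

lemma continuous_edge_path: "continuous_on S (edge_path i j)"
  unfolding edge_path_def by (intro continuous_on_coordinatewise_then_product continuous_intros)

lemma edge_path_in_realization:
  assumes "simplicial_data M" "f \<in> faces M" "i \<in> f" "j \<in> f" "t \<in> {0..1}"
  shows "edge_path i j t \<in> geometric_realization M"
proof -
  have fin: "finite f"
    using assms(1,2) unfolding simplicial_data_def by (metis card.infinite zero_neq_numeral)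
  have "(\<Sum>k\<in>f. edge_path i j t k) = 1"
    using fin assms(3,4)
    by (simp add: edge_path_def vertex_point_def sum.distrib sum_distrib_left[symmetric])
  then show ?thesis
    using assms(2-5) unfolding geometric_realization_def
    by (auto intro!: bexI[of _ f] simp: edge_path_def vertex_point_def)
qed

text \<open>
  Before the endpoint the segment lies in the star of \<open>i\<close>, after the starting point in the star of
  \<open>j\<close>.  The lift follows the step function of \<open>i\<close> to the midpoint and that of \<open>j\<close> afterwards, and
  the two step functions differ by \<open>c i j\<close>.
\<close>

lemma cochain_lift_edge_path:
  assumes c: "cochain_closed M c" and M: "simplicial_data M" "f \<in> faces M" "i \<in> f" "j \<in> f"
    and \<theta>: "cochain_lift c (edge_path i j) {0..1} \<theta>"
  shows "\<theta> 1 - \<theta> 0 = c i j"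
proof (cases "i = j")
  case True
  then have "edge_path i j = (\<lambda>t. vertex_point i)"
    by (auto simp: edge_path_def fun_eq_iff algebra_simps)
  then have "cochain_lift c (edge_path i j) {0..1} (\<lambda>_. 0)"
    by (auto simp: cochain_lift_def intro: exI[of _ UNIV])
  from cochain_lift_unique[OF \<theta> this, of 1 0] show ?thesis
    using True \<open>edge_path i j = _\<close> cochain_closed_refl[OF c M(2,3)]
    by (auto simp: vertex_point_def)
next
  case False
  let ?p = "edge_path i j"
  have *: "\<theta> a - c k (support_vertex (?p a)) = \<theta> b - c k (support_vertex (?p b))"
    if S: "connected S" "S \<subseteq> {0..1}" "a \<in> S" "b \<in> S" and pos: "\<And>t. t \<in> S \<Longrightarrow> 0 < ?p t k" for S k a b
  proof (rule cochain_lift_unique[OF cochain_lift_subset[OF \<theta> S(2)] _ S(1) _ S(3,4)])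
    show "cochain_lift c ?p S (\<lambda>t. c k (support_vertex (?p t)))"
      using cochain_lift_in_star[OF c continuous_edge_path _ pos] edge_path_in_realization[OF M] S(2)
      by blast
  qed (use pos in blast)
  have "\<theta> 0 - c i (support_vertex (?p 0)) = \<theta> (1/2) - c i (support_vertex (?p (1/2)))"
    by (rule *[of "{0..<1}"]) (use False in \<open>auto simp: edge_path_def vertex_point_def\<close>)
  moreover have "\<theta> (1/2) - c j (support_vertex (?p (1/2))) = \<theta> 1 - c j (support_vertex (?p 1))"
    by (rule *[of "{0<..1}"]) (use False in \<open>auto simp: edge_path_def vertex_point_def\<close>)
  moreover have "c j (support_vertex (?p (1/2))) = c j i + c i (support_vertex (?p (1/2)))"
    by (rule cochain_change_center[OF c edge_path_in_realization[OF M]])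
      (use False in \<open>auto simp: edge_path_def vertex_point_def\<close>)
  ultimately have "\<theta> (1/2) = \<theta> 0 + c i (support_vertex (?p (1/2)))"
    "\<theta> 1 + c i (support_vertex (?p (1/2))) = c i j + \<theta> (1/2)"
    using cochain_closed_swap[OF c M(2,3,4)] cochain_closed_refl[OF c M(2)] M(3,4)
    by (simp_all add: algebra_simps)
  then have "\<theta> 1 + c i (support_vertex (?p (1/2))) = (c i j + \<theta> 0) + c i (support_vertex (?p (1/2)))"
    by (simp add: add.assoc)
  then show ?thesis by simp
qed

text \<open>
  Edge walks enter only through their ends and their sum.  Consecutive vertices share a face and may
  coincide.
\<close>

inductive walk_sum :: "'v tri_surface \<Rightarrow> ('v \<Rightarrow> 'v \<Rightarrow> 'b::ab_group_add) \<Rightarrow> 'v \<Rightarrow> 'v \<Rightarrow> 'b \<Rightarrow> bool"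
  for M c i where
    stay: "walk_sum M c i i 0"
  | step: "walk_sum M c i j s \<Longrightarrow> f \<in> faces M \<Longrightarrow> j \<in> f \<Longrightarrow> k \<in> f \<Longrightarrow> walk_sum M c i k (s + c j k)"

lemma walk_sum_trans:
  assumes "walk_sum M c j k t" "walk_sum M c i j s"
  shows "walk_sum M c i k (s + t)"
  using assms by (induction) (auto simp: add.assoc[symmetric] intro: walk_sum.step)

lemma walk_sum_sym:
  assumes "cochain_closed M c" "walk_sum M c i j s"
  shows "walk_sum M c j i (- s)"
  using assms(2)
proof (induction)
  case stay
  show ?case using walk_sum.stay[of M c i] by simp
next
  case (step j s f k)
  have "walk_sum M c k j (- c j k)"
    using walk_sum.step[OF walk_sum.stay[of M c k] step(2,4,3)]
      cochain_closed_swap[OF assms(1) step(2,3,4)] by simp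
  from walk_sum_trans[OF step.IH this] show ?case by (simp add: add.commute)
qed

text \<open>
  The path is the concatenation of the segments of the walk.  A lift along a concatenation restricts,
  after reparametrization, to lifts along both halves, so the increments add up.
\<close>

lemma walk_sum_path:
  fixes c :: "'v \<Rightarrow> 'v \<Rightarrow> 'b::ab_group_add"
  assumes c: "cochain_closed M c" and M: "simplicial_data M"
    and "walk_sum M c i j s" and f: "f \<in> faces M" "i \<in> f"
  shows "\<exists>p. path p \<and> pathstart p = vertex_point i \<and> pathfinish p = vertex_point j
    \<and> path_image p \<subseteq> geometric_realization M
    \<and> (\<forall>\<theta>. cochain_lift c p {0..1} \<theta> \<longrightarrow> \<theta> 1 - \<theta> 0 = s)"
  using assms(3)
proof (induction)
  case stay
  have "edge_path i i ` {0..1} \<subseteq> geometric_realization M"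
    using edge_path_in_realization[OF M f f(2)] by blast
  moreover have "\<theta> 1 - \<theta> 0 = 0" if "cochain_lift c (edge_path i i) {0..1} \<theta>" for \<theta>
    using cochain_lift_edge_path[OF c M f f(2) that] cochain_closed_refl[OF c f] by simp
  ultimately show ?case
    by (intro exI[of _ "edge_path i i"])
      (auto simp: path_def continuous_edge_path pathstart_def pathfinish_def path_image_def)
next
  case (step j s f k)
  then obtain p where p: "path p" "pathstart p = vertex_point i" "pathfinish p = vertex_point j"
    "path_image p \<subseteq> geometric_realization M"
    "\<And>\<theta>. cochain_lift c p {0..1} \<theta> \<Longrightarrow> \<theta> 1 - \<theta> 0 = s" by blast
  let ?e = "edge_path j k"
  have e: "path ?e" "pathstart ?e = vertex_point j" "pathfinish ?e = vertex_point k"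
    "path_image ?e \<subseteq> geometric_realization M"
    using edge_path_in_realization[OF M step(2,3,4)]
    by (auto simp: path_def continuous_edge_path pathstart_def pathfinish_def path_image_def)
  have "\<theta> 1 - \<theta> 0 = s + c j k" if \<theta>: "cochain_lift c (p +++ ?e) {0..1} \<theta>" for \<theta>
  proof -
    have "cochain_lift c (\<lambda>t. (p +++ ?e) (t / 2)) {0..1} (\<lambda>t. \<theta> (t / 2))"
      by (rule cochain_lift_compose[OF \<theta>]) (auto intro!: continuous_intros)
    then have "cochain_lift c p {0..1} (\<lambda>t. \<theta> (t / 2))"
      by (rule cochain_lift_cong) (auto simp: joinpaths_def)
    then have 1: "\<theta> (1/2) - \<theta> 0 = s" using p(5) by force
    have "cochain_lift c (\<lambda>t. (p +++ ?e) ((t + 1) / 2)) {0..1} (\<lambda>t. \<theta> ((t + 1) / 2))"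
      by (rule cochain_lift_compose[OF \<theta>]) (auto intro!: continuous_intros)
    then have "cochain_lift c ?e {0..1} (\<lambda>t. \<theta> ((t + 1) / 2))"
      by (rule cochain_lift_cong)
        (use p(3) in \<open>auto simp: joinpaths_def pathfinish_def add_divide_distrib\<close>)
    from cochain_lift_edge_path[OF c M step(2,3,4) this] have "\<theta> 1 - \<theta> (1/2) = c j k" by simp
    then show ?thesis using 1 by (simp add: algebra_simps)
  qed
  then show ?case
    using p e by (intro exI[of _ "p +++ ?e"]) (auto simp: path_image_join)
qed

text \<open>
  A lift over a homotopy from the loop of the walk to a constant loop: its restrictions to the top and the
  bottom side are lifts of the same path, so their difference is the same at the left and at the right end.
  It is the sum of the walk at the one end and zero at the other.
\<close>

lemma closed_walk_sum_zero:
  fixes c :: "'v \<Rightarrow> 'v \<Rightarrow> 'b::ab_group_add"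
  assumes c: "cochain_closed M c" and M: "simplicial_data M"
    and sc: "simply_connected (geometric_realization M)"
    and w: "walk_sum M c i i s" and f: "f \<in> faces M" "i \<in> f"
  shows "s = 0"
proof -
  obtain p where p: "path p" "pathstart p = vertex_point i" "pathfinish p = vertex_point i"
    "path_image p \<subseteq> geometric_realization M"
    "\<And>\<theta>. cochain_lift c p {0..1} \<theta> \<Longrightarrow> \<theta> 1 - \<theta> 0 = s"
    using walk_sum_path[OF c M w f] by blast
  define q :: "real \<Rightarrow> 'v \<Rightarrow> real" where "q = (\<lambda>t. vertex_point i)"
  have "vertex_point i \<in> geometric_realization M"
    using edge_path_in_realization[OF M f f(2), of 0] by simp
  then have "path q" "pathfinish q = pathstart q" "path_image q \<subseteq> geometric_realization M"
    by (auto simp: q_def path_def pathstart_def pathfinish_def path_image_def)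
  then have "homotopic_loops (geometric_realization M) p q"
    using sc p unfolding simply_connected_def by simp
  then obtain h where h: "continuous_on ({0..1::real} \<times> {0..1::real}) h"
    "h \<in> ({0..1} \<times> {0..1}) \<rightarrow> geometric_realization M"
    "\<And>t. t \<in> {0..1} \<Longrightarrow> h (0, t) = p t" "\<And>t. t \<in> {0..1} \<Longrightarrow> h (1, t) = q t"
    "\<And>r. r \<in> {0..1} \<Longrightarrow> h (r, 1) = h (r, 0)"
    unfolding homotopic_loops by (auto simp: pathstart_def pathfinish_def)
  obtain \<theta> where \<theta>: "cochain_lift c h ({0..1} \<times> {0..1}) \<theta>"
    using cochain_lift_rectangle[OF c h(1)] h(2) by blast
  have pos: "\<exists>k. 0 < h z k" if "z \<in> {0..1} \<times> {0..1}" for z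
    using that h(2) realization_positive_coordinate by blast
  have left: "\<theta> (0, 1) - \<theta> (0, 0) = s"
  proof (rule p(5))
    have "cochain_lift c (\<lambda>t. h (0, t)) {0..1} (\<lambda>t. \<theta> (0, t))"
      by (rule cochain_lift_compose[OF \<theta>]) (auto intro!: continuous_intros)
    then show "cochain_lift c p {0..1} (\<lambda>t. \<theta> (0, t))"
      by (rule cochain_lift_cong) (use h(3) in auto)
  qed
  have right: "\<theta> (1, 1) = \<theta> (1, 0)"
  proof -
    have "cochain_lift c (\<lambda>t. h (1, t)) {0..1} (\<lambda>t. \<theta> (1, t))"
      by (rule cochain_lift_compose[OF \<theta>]) (auto intro!: continuous_intros)
    then have 1: "cochain_lift c q {0..1} (\<lambda>t. \<theta> (1, t))"
      by (rule cochain_lift_cong) (use h(4) in auto)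
    \<comment> \<open>Along a constant path all step functions are constant, so constants are lifts.\<close>
    have 2: "cochain_lift c q {0..1} (\<lambda>_. 0)"
      by (auto simp: cochain_lift_def q_def intro: exI[of _ UNIV])
    have "\<exists>k. 0 < q z k" for z
      by (auto simp: q_def vertex_point_def)
    from cochain_lift_unique[OF 1 2 _ this, of 1 0] show ?thesis by simp
  qed
  have "\<theta> (0, 1) - \<theta> (0, 0) = \<theta> (1, 1) - \<theta> (1, 0)"
  proof (rule cochain_lift_unique[of c "\<lambda>r. h (r, 0)" "{0..1}"])
    show "cochain_lift c (\<lambda>r. h (r, 0)) {0..1} (\<lambda>r. \<theta> (r, 0))"
      by (rule cochain_lift_compose[OF \<theta>]) (auto intro!: continuous_intros)
    have "cochain_lift c (\<lambda>r. h (r, 1)) {0..1} (\<lambda>r. \<theta> (r, 1))"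
      by (rule cochain_lift_compose[OF \<theta>]) (auto intro!: continuous_intros)
    then show "cochain_lift c (\<lambda>r. h (r, 0)) {0..1} (\<lambda>r. \<theta> (r, 1))"
      by (rule cochain_lift_cong) (use h(5) in auto)
  qed (use pos in auto)
  then show ?thesis using left right by simp
qed

text \<open>
  The potential of \<open>i\<close> is the sum of \<open>c\<close> along any walk to \<open>i\<close> from the chosen root of its edge-path
  component.  Two such walks differ by a closed walk, which has sum zero.
\<close>

lemma closed_cochain_exact:
  fixes c :: "'v \<Rightarrow> 'v \<Rightarrow> 'b::ab_group_add"
  assumes c: "cochain_closed M c" and M: "simplicial_data M"
    and sc: "simply_connected (geometric_realization M)"
  obtains b where "\<And>f i j. f \<in> faces M \<Longrightarrow> i \<in> f \<Longrightarrow> j \<in> f \<Longrightarrow> c i j = b j - b i"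
proof -
  define comp where "comp i = {j. \<exists>s. walk_sum M c i j s}" for i
  define root where "root i = (SOME r. r \<in> comp i)" for i
  define b where "b i = (THE s. walk_sum M c (root i) i s)" for i
  have root_walk: "\<exists>s. walk_sum M c (root i) i s" for i
  proof -
    have "i \<in> comp i"
      unfolding comp_def mem_Collect_eq by (rule exI[of _ 0]) (rule walk_sum.stay)
    then have "root i \<in> comp i" unfolding root_def by (rule someI)
    then show ?thesis using walk_sum_sym[OF c] unfolding comp_def by blast
  qed
  have b: "b i = s" if "walk_sum M c (root i) i s" "f \<in> faces M" "i \<in> f" for i s f
    unfolding b_def
  proof (rule the_equality)
    fix s' assume s': "walk_sum M c (root i) i s'"
    have "walk_sum M c i i (- s + s')"
      by (rule walk_sum_trans[OF s' walk_sum_sym[OF c that(1)]])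
    then have "- s + s' = 0" using closed_walk_sum_zero[OF c M sc] that by blast
    then show "s' = s" by (simp add: algebra_simps)
  qed (rule that(1))
  have "c i j = b j - b i" if f: "f \<in> faces M" "i \<in> f" "j \<in> f" for f i j
  proof -
    have ij: "walk_sum M c i j (0 + c i j)" and ji: "walk_sum M c j i (0 + c j i)"
      by (rule walk_sum.step[OF walk_sum.stay f] walk_sum.step[OF walk_sum.stay f(1,3,2)])+
    have "comp i = comp j"
      using walk_sum_trans[OF _ ij] walk_sum_trans[OF _ ji] unfolding comp_def by blast
    then have r: "root j = root i" by (simp add: root_def)
    obtain s where s: "walk_sum M c (root i) i s" using root_walk by blast
    have "walk_sum M c (root j) j (s + (0 + c i j))"
      unfolding r by (rule walk_sum_trans[OF ij s])
    then have "b j = s + c i j" using b f by force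
    moreover have "b i = s" using b s f by blast
    ultimately show ?thesis by simp
  qed
  then show ?thesis by (rule that)
qed

section \<open>Faces and interior edges of an oriented surface\<close>

lemma triangulated_surfaceD:
  assumes "triangulated_surface M"
  shows "simplicial_data M" "locally_surface M" "coherently_oriented M"
  using assms by (simp_all add: triangulated_surface_def)

lemma face_vertices_distinct:
  assumes "triangulated_surface M" "{i, j, k} \<in> faces M"
  shows "i \<noteq> j" "j \<noteq> k" "i \<noteq> k"
proof -
  have "card {i, j, k} = 3"
    using assms by (auto simp: triangulated_surface_def simplicial_data_def)
  then show "i \<noteq> j" "j \<noteq> k" "i \<noteq> k" by (auto simp: card_insert_if split: if_splits)
qed

lemma orient_face: "triangulated_surface M \<Longrightarrow> (i, j, k) \<in> orient M \<Longrightarrow> {i, j, k} \<in> faces M"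
  unfolding triangulated_surface_def coherently_oriented_def by blast

lemma orient_rotate: "triangulated_surface M \<Longrightarrow> (i, j, k) \<in> orient M \<Longrightarrow> (j, k, i) \<in> orient M"
  unfolding triangulated_surface_def coherently_oriented_def by blast

lemma orient_iff_not_flip:
  "triangulated_surface M \<Longrightarrow> {i, j, k} \<in> faces M \<Longrightarrow> (i, j, k) \<in> orient M \<longleftrightarrow> (j, i, k) \<notin> orient M"
  unfolding triangulated_surface_def coherently_oriented_def by blast

lemma orient_adjacent:
  "triangulated_surface M \<Longrightarrow> {i, j, k} \<in> faces M \<Longrightarrow> {i, j, l} \<in> faces M \<Longrightarrow> k \<noteq> l
    \<Longrightarrow> (i, j, k) \<in> orient M \<longleftrightarrow> (j, i, l) \<in> orient M"
  unfolding triangulated_surface_def coherently_oriented_def by blast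

lemma orient_unique_third:
  assumes M: "triangulated_surface M" and "(i, j, k) \<in> orient M" "(i, j, l) \<in> orient M"
  shows "k = l"
proof (rule ccontr)
  assume "k \<noteq> l"
  then have "(j, i, l) \<in> orient M"
    using orient_adjacent[OF M orient_face[OF M assms(2)] orient_face[OF M assms(3)]] assms(2) by blast
  then show False using orient_iff_not_flip[OF M orient_face[OF M assms(3)]] assms(3) by blast
qed

lemma orient_unique_second:
  assumes M: "triangulated_surface M" and "(i, j, l) \<in> orient M" "(i, k, l) \<in> orient M"
  shows "j = k"
  by (rule orient_unique_third[OF M orient_rotate[OF M orient_rotate[OF M assms(2)]]
        orient_rotate[OF M orient_rotate[OF M assms(3)]]])

lemma orient_not_swap:
  assumes M: "triangulated_surface M" and "(i, j, k) \<in> orient M"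
  shows "(i, k, j) \<notin> orient M"
proof
  assume "(i, k, j) \<in> orient M"
  then have "(j, i, k) \<in> orient M" by (intro orient_rotate[OF M, of k j i] orient_rotate[OF M, of i k j])
  then show False using orient_iff_not_flip[OF M orient_face[OF M assms(2)]] assms(2) by blast
qed

lemma orient_cases:
  assumes M: "triangulated_surface M" and "{i, j, k} \<in> faces M"
  shows "(i, j, k) \<in> orient M \<or> (i, k, j) \<in> orient M"
  using orient_iff_not_flip[OF assms] orient_rotate[OF M, of j i k] by blast

lemma left_face_eq:
  assumes "triangulated_surface M" "(i, j, k) \<in> orient M"
  shows "left_face M i j = {i, j, k}"
  unfolding left_face_def
proof (rule the_equality)
  fix f assume "\<exists>l. (i, j, l) \<in> orient M \<and> f = {i, j, l}"
  then show "f = {i, j, k}" using orient_unique_third[OF assms] by blast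
qed (use assms(2) in blast)

lemma right_face_eq:
  assumes M: "triangulated_surface M" and "(i, k, j) \<in> orient M"
  shows "right_face M i j = {i, k, j}"
  using left_face_eq[OF M orient_rotate[OF M orient_rotate[OF M assms(2)]]]
  by (simp add: right_face_def insert_commute)

lemma face_third_vertex:
  assumes M: "triangulated_surface M" and f: "f \<in> faces M" "{i, j} \<subseteq> f" "i \<noteq> j"
  obtains k where "f = {i, j, k}"
proof -
  have "card f = 3" using M f(1) by (auto simp: triangulated_surface_def simplicial_data_def)
  then have "card (f - {i, j}) = 1" using f by (simp add: card_Diff_subset)
  then obtain k where "f - {i, j} = {k}" using card_1_singletonE by blast
  then have "f = {i, j, k}" using f(2) by blast
  then show ?thesis by (rule that)
qed

text \<open>
  Coherence of the orientation: of the two faces at an edge one contains \<open>i, j\<close> in positive cyclic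
  order and the other \<open>j, i\<close>.
\<close>

lemma orient_two_sides:
  assumes M: "triangulated_surface M" and f: "{i, j, k} \<in> faces M" "{i, j, l} \<in> faces M" "k \<noteq> l"
  shows "(i, j, k) \<in> orient M \<and> (i, l, j) \<in> orient M \<or> (i, k, j) \<in> orient M \<and> (i, j, l) \<in> orient M"
proof (cases "(i, j, k) \<in> orient M")
  case True
  then have "(j, i, l) \<in> orient M" using orient_adjacent[OF M f] by blast
  then show ?thesis using True orient_rotate[OF M, of j i l] by blast
next
  case False
  then have ikj: "(i, k, j) \<in> orient M" using orient_cases[OF M f(1)] by blast
  then have "(j, i, k) \<in> orient M" by (intro orient_rotate[OF M, of k j i] orient_rotate[OF M, of i k j])
  then have "(i, j, l) \<in> orient M" using orient_adjacent[OF M f(2,1)] f(3) by blast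
  then show ?thesis using ikj by blast
qed

lemma edge_iff_face:
  assumes M: "triangulated_surface M"
  shows "{i, j} \<in> edges M \<longleftrightarrow> (\<exists>k. {i, j, k} \<in> faces M)"
proof
  assume "{i, j} \<in> edges M"
  then have "card {i, j} = 2" and "\<exists>f\<in>faces M. {i, j} \<subseteq> f"
    using M by (auto simp: triangulated_surface_def simplicial_data_def)
  then obtain f where f: "f \<in> faces M" "{i, j} \<subseteq> f" and "i \<noteq> j"
    by (auto simp: card_2_iff doubleton_eq_iff)
  then show "\<exists>k. {i, j, k} \<in> faces M" using face_third_vertex[OF M] by metis
next
  assume "\<exists>k. {i, j, k} \<in> faces M"
  then obtain k where k: "{i, j, k} \<in> faces M" by blast
  then have "i \<noteq> j" using face_vertices_distinct[OF M] by blast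
  then have "card {i, j} = 2" by simp
  then show "{i, j} \<in> edges M"
    using M k unfolding triangulated_surface_def simplicial_data_def by auto
qed

lemma edge_ends_distinct: "triangulated_surface M \<Longrightarrow> {i, j} \<in> edges M \<Longrightarrow> i \<noteq> j"
  by (auto simp: edge_iff_face dest: face_vertices_distinct)

lemma edge_ends_in_verts:
  assumes M: "triangulated_surface M" and "{i, j} \<in> edges M"
  shows "i \<in> verts M" "j \<in> verts M"
  using assms(2) M unfolding edge_iff_face[OF M] by (auto simp: triangulated_surface_def simplicial_data_def)

lemma interior_edge_iff:
  assumes M: "triangulated_surface M"
  shows "{i, j} \<in> interior_edges M \<longleftrightarrow> (\<exists>k l. (i, j, k) \<in> orient M \<and> (i, l, j) \<in> orient M)"
proof
  assume e: "{i, j} \<in> interior_edges M"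
  then have "{i, j} \<in> edges M" "card {f\<in>faces M. {i, j} \<subseteq> f} = 2"
    by (auto simp: interior_edges_def)
  then obtain f g where fg: "{f\<in>faces M. {i, j} \<subseteq> f} = {f, g}" "f \<noteq> g"
    by (meson card_2_iff)
  have ij: "i \<noteq> j" using \<open>{i, j} \<in> edges M\<close> edge_ends_distinct M by metis
  have "f \<in> {f\<in>faces M. {i, j} \<subseteq> f}" "g \<in> {f\<in>faces M. {i, j} \<subseteq> f}"
    unfolding fg(1) by auto
  then have F: "f \<in> faces M" "{i, j} \<subseteq> f" "g \<in> faces M" "{i, j} \<subseteq> g" by auto
  obtain k l where kl: "f = {i, j, k}" "g = {i, j, l}"
    using face_third_vertex[OF M F(1,2) ij] face_third_vertex[OF M F(3,4) ij] by metis
  then have "k \<noteq> l" using fg(2) by blast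
  then show "\<exists>k l. (i, j, k) \<in> orient M \<and> (i, l, j) \<in> orient M"
    using orient_two_sides[OF M, of i j k l] F(1,3) kl by blast
next
  assume "\<exists>k l. (i, j, k) \<in> orient M \<and> (i, l, j) \<in> orient M"
  then obtain k l where kl: "(i, j, k) \<in> orient M" "(i, l, j) \<in> orient M" by blast
  have F: "{i, j, k} \<in> faces M" "{i, l, j} \<in> faces M" using orient_face[OF M] kl by auto
  have "k \<noteq> l" using orient_not_swap[OF M] kl by blast
  then have "k \<notin> {i, l, j}" using face_vertices_distinct[OF M F(1)] by simp
  then have ne: "{i, j, k} \<noteq> {i, l, j}" by blast
  have e: "{i, j} \<in> edges M" using edge_iff_face[OF M] F(1) by blast
  then have c: "card {f\<in>faces M. {i, j} \<subseteq> f} \<in> {1, 2}"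
    using triangulated_surfaceD(2)[OF M] unfolding locally_surface_def by blast
  have "\<not> is_singleton {f\<in>faces M. {i, j} \<subseteq> f}"
  proof
    assume "is_singleton {f\<in>faces M. {i, j} \<subseteq> f}"
    then obtain h where "{f\<in>faces M. {i, j} \<subseteq> f} = {h}" by (rule is_singletonE)
    moreover have "{i, j, k} \<in> {f\<in>faces M. {i, j} \<subseteq> f}" "{i, l, j} \<in> {f\<in>faces M. {i, j} \<subseteq> f}"
      using F by auto
    ultimately show False using ne by simp
  qed
  then have "card {f\<in>faces M. {i, j} \<subseteq> f} = 2" using c by (simp add: is_singleton_altdef)
  then show "{i, j} \<in> interior_edges M" using e by (simp add: interior_edges_def)
qed

lemma two_faces_interior_edge:
  assumes M: "triangulated_surface M" and f: "f \<in> faces M" "g \<in> faces M" "f \<noteq> g"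
    and "i \<noteq> j" "{i, j} \<subseteq> f" "{i, j} \<subseteq> g"
  shows "{i, j} \<in> interior_edges M"
    and "(f = left_face M i j \<and> g = right_face M i j) \<or> (f = right_face M i j \<and> g = left_face M i j)"
proof -
  obtain k l where kl: "f = {i, j, k}" "g = {i, j, l}"
    using face_third_vertex[OF M f(1) assms(6,5)] face_third_vertex[OF M f(2) assms(7,5)] by metis
  have "k \<noteq> l" using kl f(3) by blast
  from orient_two_sides[OF M f(1,2)[unfolded kl] this]
  show "{i, j} \<in> interior_edges M"
    and "(f = left_face M i j \<and> g = right_face M i j) \<or> (f = right_face M i j \<and> g = left_face M i j)"
    unfolding interior_edge_iff[OF M]
    using left_face_eq[OF M] right_face_eq[OF M] by (auto simp: kl insert_commute)
qed

lemma finite_neighbors: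
  assumes M: "triangulated_surface M"
  shows "finite (neighbors M i)"
proof (cases "i \<in> verts M")
  case True
  have "finite f" if "f \<in> faces M" for f
    using triangulated_surfaceD(1)[OF M] that unfolding simplicial_data_def
    by (metis card.infinite zero_neq_numeral)
  moreover have "finite {f\<in>faces M. i \<in> f}"
    using True triangulated_surfaceD(2)[OF M] by (auto simp: locally_surface_def)
  ultimately have "finite (\<Union> {f\<in>faces M. i \<in> f})" by blast
  moreover have "neighbors M i \<subseteq> \<Union> {f\<in>faces M. i \<in> f}"
    by (auto simp: neighbors_def edge_iff_face[OF M])
  ultimately show ?thesis by (rule finite_subset[rotated])
next
  case False
  then have "neighbors M i = {}" using edge_ends_in_verts[OF M] by (auto simp: neighbors_def)
  then show ?thesis by simp
qed

lemma orient_neighbors: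
  assumes M: "triangulated_surface M" and "(i, j, k) \<in> orient M"
  shows "j \<in> neighbors M i" "k \<in> neighbors M i"
proof -
  have "{i, j, k} \<in> faces M" "{i, k, j} \<in> faces M"
    using orient_face[OF assms] by (simp_all add: insert_commute)
  then show "j \<in> neighbors M i" "k \<in> neighbors M i"
    unfolding neighbors_def mem_Collect_eq edge_iff_face[OF M] by blast+
qed

lemma interior_vertex_edge:
  "i \<in> interior_verts M \<Longrightarrow> j \<in> neighbors M i \<Longrightarrow> {i, j} \<in> interior_edges M"
  by (auto simp: interior_verts_def neighbors_def)

section \<open>Closed and exact dual differences\<close>

text \<open>
  Rotating about the vertex, the left face of each edge is the right face of the next one, so the
  sum telescopes.
\<close>

lemma sum_dual_diff_interior_vertex:
  assumes M: "triangulated_surface M" and i: "i \<in> interior_verts M"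
  shows "(\<Sum>j\<in>neighbors M i. dual_diff M f i j) = 0"
proof -
  have "\<exists>k. (i, j, k) \<in> orient M" if "j \<in> neighbors M i" for j
    using interior_vertex_edge[OF i that] interior_edge_iff[OF M] by blast
  then obtain s where s: "\<And>j. j \<in> neighbors M i \<Longrightarrow> (i, j, s j) \<in> orient M" by metis
  have "inj_on s (neighbors M i)"
    using s orient_unique_second[OF M] by (metis inj_onI)
  moreover have "s ` neighbors M i \<subseteq> neighbors M i" using s orient_neighbors[OF M] by blast
  ultimately have bij: "bij_betw s (neighbors M i) (neighbors M i)"
    using endo_inj_surj[OF finite_neighbors[OF M]] by (auto simp: bij_betw_def)
  have "(\<Sum>j\<in>neighbors M i. f (right_face M i j)) = (\<Sum>j\<in>neighbors M i. f (right_face M i (s j)))"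
    by (rule sum.reindex_bij_betw[OF bij, symmetric])
  also have "\<dots> = (\<Sum>j\<in>neighbors M i. f (left_face M i j))"
    by (rule sum.cong) (simp_all add: left_face_eq[OF M s] right_face_eq[OF M s])
  finally show ?thesis by (simp add: dual_diff_def sum_subtractf)
qed

text \<open>
  Counterclockwise succession of the neighbours of \<open>i\<close> is a path or a cycle, and a face at \<open>i\<close> is a
  pair of successive neighbours.  A potential on the neighbours becomes a potential on the faces
  by giving the face \<open>{i, j, k}\<close> the value at \<open>j\<close>, the first of the pair.  The relation is a cycle only if
  every edge at \<open>i\<close> is interior.
\<close>

lemma local_dual_potential:
  fixes w :: "'v \<Rightarrow> 'b::ab_group_add"
  assumes M: "triangulated_surface M"
    and closed: "i \<in> interior_verts M \<Longrightarrow> sum w (neighbors M i) = 0"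
  obtains g where "\<And>j. {i, j} \<in> interior_edges M \<Longrightarrow> g (left_face M i j) - g (right_face M i j) = w j"
proof -
  define R where "R = {(j, k). (i, j, k) \<in> orient M}"
  define A where "A = neighbors M i"
  have finA: "finite A" using finite_neighbors[OF M] by (simp add: A_def)
  have R: "(j, k) \<in> R \<longleftrightarrow> (i, j, k) \<in> orient M" for j k by (simp add: R_def)
  have RA: "R \<subseteq> A \<times> A" using orient_neighbors[OF M] by (auto simp: R_def A_def)
  have func: "\<And>x y z. (x, y) \<in> R \<Longrightarrow> (x, z) \<in> R \<Longrightarrow> y = z"
    using orient_unique_third[OF M] unfolding R by blast
  have inj: "\<And>x y z. (x, z) \<in> R \<Longrightarrow> (y, z) \<in> R \<Longrightarrow> x = y"
    using orient_unique_second[OF M] unfolding R by blast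
  have conn: "(x, y) \<in> (R \<union> R\<inverse>)\<^sup>*" if "x \<in> A" "y \<in> A" for x y
  proof -
    have "(x, y) \<in> {(x, y). {i, x, y} \<in> faces M}\<^sup>*"
      using triangulated_surfaceD(2)[OF M] that by (simp add: locally_surface_def A_def neighbors_def)
    moreover have "{(x, y). {i, x, y} \<in> faces M} \<subseteq> R \<union> R\<inverse>"
    proof (rule subrelI)
      fix x y assume "(x, y) \<in> {(x, y). {i, x, y} \<in> faces M}"
      then show "(x, y) \<in> R \<union> R\<inverse>" using orient_cases[OF M, of i x y] by (auto simp: R)
    qed
    ultimately show ?thesis using rtrancl_mono by blast
  qed
  have total: "sum w A = 0" if tot: "\<And>x. x \<in> A \<Longrightarrow> \<exists>y. (x, y) \<in> R"
  proof (cases "i \<in> verts M")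
    case True
    have pred: "\<exists>x\<in>A. (x, y) \<in> R" if "y \<in> A" for y
    proof (rule finite_injective_relation_total_imp_onto[OF finA _ inj that])
      show "\<exists>y\<in>A. (x, y) \<in> R" if "x \<in> A" for x
        using tot[OF that] RA by blast
    qed
    have "e \<in> interior_edges M" if e: "e \<in> edges M" "i \<in> e" for e
    proof -
      have "card e = 2" using e(1) M by (auto simp: triangulated_surface_def simplicial_data_def)
      then obtain j where j: "e = {i, j}" using e(2) by (auto simp: card_2_iff)
      then have "j \<in> A" using e(1) by (simp add: A_def neighbors_def)
      from tot[OF this] pred[OF this] show ?thesis
        unfolding j interior_edge_iff[OF M] R by blast
    qed
    then have "i \<in> interior_verts M" using True by (simp add: interior_verts_def)
    then show ?thesis using closed by (simp add: A_def)
  next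
    case False
    then have "A = {}" using edge_ends_in_verts[OF M] by (auto simp: A_def neighbors_def)
    then show ?thesis by simp
  qed
  have "\<exists>G. \<forall>x y. (x, y) \<in> R \<longrightarrow> G y = G x + w y"
  proof (rule potential_on_path_or_cycle[of A R w])
    show "\<And>x y z. (x, y) \<in> R \<Longrightarrow> (x, z) \<in> R \<Longrightarrow> y = z" by (rule func)
    show "\<And>x y z. (x, z) \<in> R \<Longrightarrow> (y, z) \<in> R \<Longrightarrow> x = y" by (rule inj)
    show "\<And>x y. x \<in> A \<Longrightarrow> y \<in> A \<Longrightarrow> (x, y) \<in> (R \<union> R\<inverse>)\<^sup>*" by (rule conn)
    show "(\<And>x. x \<in> A \<Longrightarrow> \<exists>y. (x, y) \<in> R) \<Longrightarrow> sum w A = 0" by (rule total)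
  qed (use finA RA in blast)+
  then obtain G where G: "\<And>x y. (x, y) \<in> R \<Longrightarrow> G y = G x + w y" by blast
  define g where "g f = G (THE j. \<exists>k. f = {i, j, k} \<and> (i, j, k) \<in> orient M)" for f
  have g: "g {i, j, k} = G j" if o: "(i, j, k) \<in> orient M" for j k
  proof -
    have "(THE j'. \<exists>k'. {i, j, k} = {i, j', k'} \<and> (i, j', k') \<in> orient M) = j"
    proof (rule the_equality)
      fix j' assume "\<exists>k'. {i, j, k} = {i, j', k'} \<and> (i, j', k') \<in> orient M"
      then obtain k' where k': "{i, j, k} = {i, j', k'}" "(i, j', k') \<in> orient M" by blast
      have "{j, k} = {i, j, k} - {i}" "{j', k'} = {i, j', k'} - {i}"
        using face_vertices_distinct[OF M orient_face[OF M o]]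
          face_vertices_distinct[OF M orient_face[OF M k'(2)]] by auto
      then have "{j, k} = {j', k'}" using k'(1) by simp
      then have "j' = j \<or> j' = k \<and> k' = j" by (auto simp: doubleton_eq_iff)
      then show "j' = j" using orient_not_swap[OF M o] k'(2) by blast
    next
      show "\<exists>k'. {i, j, k} = {i, j, k'} \<and> (i, j, k') \<in> orient M" using o by blast
    qed
    then show ?thesis by (simp add: g_def)
  qed
  have "g (left_face M i j) - g (right_face M i j) = w j" if ij: "{i, j} \<in> interior_edges M" for j
  proof -
    obtain k l where kl: "(i, j, k) \<in> orient M" "(i, l, j) \<in> orient M"
      using ij interior_edge_iff[OF M] by blast
    then show ?thesis
      using G[of l j] by (simp add: left_face_eq[OF M kl(1)] right_face_eq[OF M kl(2)] g R)
  qed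
  then show ?thesis by (rule that)
qed

lemma face_sides:
  assumes M: "triangulated_surface M" and "{i, j} \<in> interior_edges M"
  shows "left_face M i j \<in> faces M" "right_face M i j \<in> faces M"
    "{i, j} \<subseteq> left_face M i j" "{i, j} \<subseteq> right_face M i j"
proof -
  obtain k l where kl: "(i, j, k) \<in> orient M" "(i, l, j) \<in> orient M"
    using assms(2) interior_edge_iff[OF M] by blast
  show "left_face M i j \<in> faces M" "right_face M i j \<in> faces M"
    "{i, j} \<subseteq> left_face M i j" "{i, j} \<subseteq> right_face M i j"
    using orient_face[OF M kl(1)] orient_face[OF M kl(2)]
    by (simp_all add: left_face_eq[OF M kl(1)] right_face_eq[OF M kl(2)])
qed

text \<open>
  The Poincare lemma for dual 1-cochains.  The local primitives \<open>g i\<close> and \<open>g j\<close> have the same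
  difference across the edge from \<open>i\<close> to \<open>j\<close>, so \<open>c i j = g i - g j\<close> is the same on all faces
  containing both vertices.  Writing \<open>c\<close> as a coboundary yields shifts that make the local primitives agree.
\<close>

lemma dual_closed_imp_exact:
  fixes \<omega> :: "'v \<Rightarrow> 'v \<Rightarrow> 'b::ab_group_add"
  assumes M: "triangulated_surface M" and sc: "simply_connected_surface M"
    and skew: "\<And>i j. {i, j} \<in> interior_edges M \<Longrightarrow> \<omega> j i = - \<omega> i j"
    and closed: "\<And>i. i \<in> interior_verts M \<Longrightarrow> (\<Sum>j\<in>neighbors M i. \<omega> i j) = 0"
  obtains f where "\<And>i j. {i, j} \<in> interior_edges M \<Longrightarrow> f (left_face M i j) - f (right_face M i j) = \<omega> i j"
proof -
  have "\<exists>g. \<forall>j. {i, j} \<in> interior_edges M \<longrightarrow> g (left_face M i j) - g (right_face M i j) = \<omega> i j" for i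
  proof (rule local_dual_potential[OF M, of i "\<omega> i"])
    show "i \<in> interior_verts M \<Longrightarrow> sum (\<omega> i) (neighbors M i) = 0" by (rule closed)
  qed blast
  then obtain g where g: "\<And>i j. {i, j} \<in> interior_edges M \<Longrightarrow>
      g i (left_face M i j) - g i (right_face M i j) = \<omega> i j" by metis
  have g': "g j (left_face M i j) - g j (right_face M i j) = \<omega> i j"
    if "{i, j} \<in> interior_edges M" for i j
  proof -
    have "g j (right_face M i j) - g j (left_face M i j) = - \<omega> i j"
      using g[of j i] skew[OF that] that by (simp add: insert_commute right_face_def)
    then show ?thesis by (metis minus_diff_eq minus_minus)
  qed
  have indep: "g i f - g j f = g i f' - g j f'"
    if f: "f \<in> faces M" "f' \<in> faces M" "{i, j} \<subseteq> f" "{i, j} \<subseteq> f'" for i j f f'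
  proof (cases "i = j \<or> f = f'")
    case False
    then have e: "{i, j} \<in> interior_edges M" and
      "(f = left_face M i j \<and> f' = right_face M i j) \<or> (f = right_face M i j \<and> f' = left_face M i j)"
      using two_faces_interior_edge[OF M f(1,2) _ _ f(3,4)] by blast+
    moreover have "g i (left_face M i j) - g j (left_face M i j) = g i (right_face M i j) - g j (right_face M i j)"
      using g[OF e] g'[OF e] by (metis add_diff_cancel_left diff_add_cancel)
    ultimately show ?thesis by auto
  qed auto
  define c where "c i j = (let f = SOME f. f \<in> faces M \<and> {i, j} \<subseteq> f in g i f - g j f)" for i j
  have c: "c i j = g i f - g j f" if "f \<in> faces M" "i \<in> f" "j \<in> f" for i j f
  proof -
    define f' where "f' = (SOME f. f \<in> faces M \<and> {i, j} \<subseteq> f)"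
    have "f' \<in> faces M \<and> {i, j} \<subseteq> f'"
      unfolding f'_def by (rule someI[of _ f]) (use that in auto)
    then show ?thesis
      using indep[of f f' i j] that unfolding c_def f'_def[symmetric] Let_def by simp
  qed
  have "cochain_closed M c"
    unfolding cochain_closed_def
  proof (intro ballI)
    fix f i j k assume "f \<in> faces M" "i \<in> f" "j \<in> f" "k \<in> f"
    then show "c i j + c j k = c i k" using c[of f i j] c[of f j k] c[of f i k] by simp
  qed
  from closed_cochain_exact[OF this triangulated_surfaceD(1)[OF M] sc[unfolded simply_connected_surface_def]]
  obtain b where b: "\<And>f i j. f \<in> faces M \<Longrightarrow> i \<in> f \<Longrightarrow> j \<in> f \<Longrightarrow> c i j = b j - b i"
    by blast
  define F where "F f = (let i = SOME i. i \<in> f in g i f + b i)" for f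
  have F: "F f = g i f + b i" if f: "f \<in> faces M" "i \<in> f" for f i
  proof -
    define i' where "i' = (SOME i. i \<in> f)"
    have "i' \<in> f" unfolding i'_def using f(2) by (rule someI)
    then have "g i f - g i' f = b i' - b i"
      using b[of f i i'] c[of f i i'] f by simp
    then show ?thesis by (simp add: F_def i'_def[symmetric] Let_def algebra_simps)
  qed
  have "F (left_face M i j) - F (right_face M i j) = \<omega> i j" if e: "{i, j} \<in> interior_edges M" for i j
    using F[of _ i] face_sides[OF M e] g[OF e] by simp
  then show ?thesis by (rule that)
qed

section \<open>Unit vectors, dihedral angles and edge points\<close>

text \<open>
  The equality case of the Cauchy-Schwarz inequality.
\<close>

lemma cross3_ne_0_of_unit:
  fixes a b :: "real^3"
  assumes "norm a = 1" "norm b = 1" "a \<noteq> b" "a \<noteq> - b"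
  shows "cross3 a b \<noteq> 0"
proof
  assume "cross3 a b = 0"
  then have "(a \<bullet> b)\<^sup>2 = 1"
    using norm_cross_dot[of a b] assms(1,2) by simp
  then have "\<bar>a \<bullet> b\<bar> = norm a * norm b"
    using assms(1,2) power2_eq_1_iff by fastforce
  then show False
    using norm_cauchy_schwarz_abs_eq[of a b] assms by auto
qed

lemma one_plus_inner_pos:
  fixes a b :: "real^3"
  assumes "norm a = 1" "norm b = 1" "a \<noteq> - b"
  shows "0 < 1 + a \<bullet> b"
proof -
  have "0 < (norm (a + b))\<^sup>2"
    using assms(3) by (simp add: add_eq_0_iff2)
  also have "(norm (a + b))\<^sup>2 = 2 * (1 + a \<bullet> b)"
    using assms(1,2) dot_norm[of a b] by simp
  finally show ?thesis by simp
qed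

lemma cross3_sum_cross3:
  fixes a b :: "real^3"
  assumes "norm a = 1" "norm b = 1"
  shows "cross3 (a + b) (cross3 a b) = (1 + a \<bullet> b) *\<^sub>R (a - b)"
proof -
  have "a \<bullet> a = 1" "b \<bullet> b = 1"
    using assms by (simp_all add: norm_eq_1)
  then show ?thesis
    by (simp add: Lagrange inner_add_left inner_commute algebra_simps)
qed

text \<open>
  The angle is \<open>2 arctan (s / (1 + c))\<close>; this lies in the open interval from \<open>-\<pi>\<close> to \<open>\<pi>\<close>, and
  no other angle in it has the same sine and cosine.
\<close>

lemma half_angle_tan_of_cos_sin:
  fixes s c :: real
  assumes "s\<^sup>2 + c\<^sup>2 = 1" "0 < 1 + c"
  shows "tan ((THE \<alpha>. - pi < \<alpha> \<and> \<alpha> < pi \<and> sin \<alpha> = s \<and> cos \<alpha> = c) / 2) = s / (1 + c)"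
proof -
  define t where "t = 2 * arctan (s / (1 + c))"
  have s2: "s\<^sup>2 = (1 - c) * (1 + c)"
    using assms(1) by (simp add: power2_eq_square algebra_simps)
  have tb: "- pi < t" "t < pi"
    using arctan_bounded[of "s / (1 + c)"] by (auto simp: t_def)
  have th: "tan (t / 2) = s / (1 + c)"
    by (simp add: t_def tan_arctan)
  have den: "1 + (tan (t/2))\<^sup>2 = 2 / (1 + c)"
  proof -
    have "(tan (t/2))\<^sup>2 = (1 - c) / (1 + c)"
      unfolding th power_divide s2 using assms(2) by (simp add: power2_eq_square)
    then show ?thesis using assms(2) by (simp add: add_divide_eq_iff)
  qed
  have cosne: "cos (t / 2) \<noteq> 0"
    using tb by (intro less_imp_neq[symmetric] cos_gt_zero_pi) auto
  have c2: "(cos (t/2))\<^sup>2 = (1 + c) / 2"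
    using tan_sec[OF cosne] den assms(2) cosne by (simp add: field_simps)
  have ct: "cos t = c"
    using cos_double_cos[of "t/2"] c2 by (simp add: add_divide_distrib)
  have "sin (t/2) = tan (t/2) * cos (t/2)"
    using cosne by (simp add: tan_def)
  then have "sin t = 2 * tan (t/2) * (cos (t/2))\<^sup>2"
    using sin_double[of "t/2"] by (simp add: power2_eq_square)
  then have st: "sin t = s"
    using c2 th assms(2) by simp
  have "(THE \<alpha>. - pi < \<alpha> \<and> \<alpha> < pi \<and> sin \<alpha> = s \<and> cos \<alpha> = c) = t"
  proof (rule the_equality)
    show "- pi < t \<and> t < pi \<and> sin t = s \<and> cos t = c" using tb st ct by blast
  next
    fix u assume u: "- pi < u \<and> u < pi \<and> sin u = s \<and> cos u = c"
    then obtain n where n: "u = t + 2 * pi * of_int n"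
      using sin_cos_eq_iff[of u t] st ct by auto
    have "\<bar>2 * pi * of_int n\<bar> < 2 * pi"
      using u tb n by linarith
    then have "\<bar>of_int n :: real\<bar> < 1"
      by (simp add: abs_mult)
    then have "n = 0" by linarith
    then show "u = t" using n by simp
  qed
  then show ?thesis using th by simp
qed

text \<open>
  The sine of the angle is \<open>sgn k * norm x\<close> with \<open>x = cross3 (N i) (N j)\<close>, so the term is
  \<open>k * (norm x)\<^sup>2 / (1 + c)\<close> where \<open>c = N i \<bullet> N j\<close> and
  \<open>(norm x)\<^sup>2 = 1 - c\<^sup>2\<close>.  The sign of \<open>k\<close> is absorbed by the sign of the angle.
\<close>

lemma norm_times_tan_dihedral_angle:
  assumes "norm (N i) = 1" "norm (N j) = 1" "N i \<noteq> N j" "N i \<noteq> - N j"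
    and D: "dual_diff M f i j = k *\<^sub>R cross3 (N i) (N j)"
  shows "(if dual_diff M f i j = 0 then 0
          else norm (dual_diff M f i j) * tan (dihedral_angle M N f i j / 2))
         = k * (1 - N i \<bullet> N j)"
proof (cases "k = 0")
  case True
  then show ?thesis using D by simp
next
  case False
  define x where "x = cross3 (N i) (N j)"
  define c where "c = N i \<bullet> N j"
  have x0: "x \<noteq> 0" and c1: "0 < 1 + c"
    using cross3_ne_0_of_unit one_plus_inner_pos assms(1-4) by (auto simp: x_def c_def)
  have nx: "(norm x)\<^sup>2 + c\<^sup>2 = 1"
    using norm_cross_dot[of "N i" "N j"] assms(1,2) by (simp add: x_def c_def)
  have sin_val: "x \<bullet> (dual_diff M f i j /\<^sub>R norm (dual_diff M f i j)) = sgn k * norm x"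
    using False x0 unfolding D x_def[symmetric]
    by (simp add: sgn_real_def power2_norm_eq_inner[symmetric] power2_eq_square field_simps)
  have "tan (dihedral_angle M N f i j / 2) = sgn k * norm x / (1 + c)"
    unfolding dihedral_angle_def x_def[symmetric] sin_val c_def[symmetric]
  proof (rule half_angle_tan_of_cos_sin)
    show "(sgn k * norm x)\<^sup>2 + c\<^sup>2 = 1"
      using nx False by (auto simp: power_mult_distrib sgn_real_def)
  qed (rule c1)
  then have "norm (dual_diff M f i j) * tan (dihedral_angle M N f i j / 2)
             = (\<bar>k\<bar> * sgn k) * (norm x)\<^sup>2 / (1 + c)"
    unfolding D x_def[symmetric] by (simp add: power2_eq_square)
  also have "\<dots> = k * ((1 - c) * (1 + c)) / (1 + c)"
  proof -
    have "(norm x)\<^sup>2 = (1 - c) * (1 + c)"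
      using nx by (simp add: power2_eq_square algebra_simps)
    then show ?thesis by (simp add: abs_mult_sgn)
  qed
  also have "\<dots> = k * (1 - c)" using c1 by simp
  finally show ?thesis using False x0 unfolding D x_def[symmetric] c_def by simp
qed

lemma edge_point_torque:
  assumes "norm (N i) = 1" "norm (N j) = 1" "N i \<noteq> - N j"
  shows "cross3 (edge_point N i j) (k *\<^sub>R cross3 (N i) (N j)) = k *\<^sub>R (N i - N j)"
  using one_plus_inner_pos[OF assms] cross3_sum_cross3[OF assms(1,2)]
  by (simp add: edge_point_def cross_mult_left cross_mult_right)

text \<open>
  The orthogonal complement of two independent vectors in space is the line spanned by their cross
  product.
\<close>

lemma orthogonal_pair_parallel:
  fixes a b v w :: "real^3"
  assumes "cross3 a b \<noteq> 0" "v \<bullet> a = 0" "v \<bullet> b = 0" "w \<bullet> a = 0" "w \<bullet> b = 0" "w \<noteq> 0"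
  obtains t where "v = t *\<^sub>R w"
proof -
  have par: "\<exists>t. u = t *\<^sub>R cross3 a b" if "u \<bullet> a = 0" "u \<bullet> b = 0" for u
  proof -
    have "cross3 (cross3 a b) u = 0"
      using that Lagrange[of u a b] cross_skew[of "cross3 a b" u] by simp
    then show ?thesis
      using assms(1) by (auto simp: cross_eq_0 collinear_lemma intro: exI[of _ 0])
  qed
  obtain s t where st: "v = s *\<^sub>R cross3 a b" "w = t *\<^sub>R cross3 a b"
    using par assms by metis
  with assms(6) have "v = (s / t) *\<^sub>R w" by auto
  then show ?thesis by (rule that)
qed

text \<open>
  The edge point has inner product 1 with \<open>N i\<close> and with \<open>N j\<close>, as do \<open>p\<close> and \<open>q\<close>; the solutions of
  these two equations form a line.
\<close>

lemma edge_point_on_polar_line: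
  fixes N :: "'v \<Rightarrow> real^3"
  assumes "norm (N i) = 1" "norm (N j) = 1" "N i \<noteq> N j" "N i \<noteq> - N j"
    and "p \<noteq> q"
    and "N i \<bullet> p = 1" "N j \<bullet> p = 1" "N i \<bullet> q = 1" "N j \<bullet> q = 1"
  shows "edge_point N i j \<in> affine hull {p, q}"
proof -
  have ii: "N i \<bullet> N i = 1" "N j \<bullet> N j = 1"
    using assms(1,2) by (simp_all add: norm_eq_1)
  have pos: "0 < 1 + N i \<bullet> N j"
    using one_plus_inner_pos assms by blast
  have r: "edge_point N i j \<bullet> N i = 1" "edge_point N i j \<bullet> N j = 1"
    using pos ii
    by (simp_all add: edge_point_def inner_add_left inner_commute[of "N j" "N i"] divide_inverse[symmetric]
        add.commute del: scaleR_right_distrib)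
  obtain t where "edge_point N i j - p = t *\<^sub>R (q - p)"
  proof (rule orthogonal_pair_parallel[of "N i" "N j" "edge_point N i j - p" "q - p"])
    show "cross3 (N i) (N j) \<noteq> 0" using cross3_ne_0_of_unit assms by blast
  qed (use assms r in \<open>simp_all add: inner_diff_left inner_commute[of _ "N _"] inner_diff_right\<close>)
  then have "edge_point N i j = (1 - t) *\<^sub>R p + t *\<^sub>R q"
    by (simp add: algebra_simps)
  then show ?thesis
    unfolding affine_hull_2 by (intro CollectI exI[of _ "1 - t"] exI[of _ t]) simp
qed

text \<open>
  With \<open>T\<close> the sum on the right, the force is \<open>- cross3 (N i) T\<close> and the curvature sum is the inner
  product of \<open>N i\<close> and \<open>T\<close>.  Together they determine \<open>T\<close>.
\<close>

lemma torque_zero_iff: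
  fixes N :: "'v \<Rightarrow> real^3"
  assumes "norm (N i) = 1"
  shows "(\<Sum>j\<in>A. k j *\<^sub>R cross3 (N i) (N j)) = 0 \<and> (\<Sum>j\<in>A. k j * (1 - N i \<bullet> N j)) = 0
     \<longleftrightarrow> (\<Sum>j\<in>A. k j *\<^sub>R (N i - N j)) = 0"
proof -
  define T where "T = (\<Sum>j\<in>A. k j *\<^sub>R (N i - N j))"
  have ii: "N i \<bullet> N i = 1" using assms by (simp add: norm_eq_1)
  have H: "(\<Sum>j\<in>A. k j * (1 - N i \<bullet> N j)) = N i \<bullet> T"
    by (simp add: T_def inner_sum_right inner_diff_right ii)
  have F: "(\<Sum>j\<in>A. k j *\<^sub>R cross3 (N i) (N j)) = - cross3 (N i) T"
  proof -
    interpret c: linear "cross3 (N i)"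
      using bilinear_cross by (simp add: bilinear_def)
    show ?thesis
      by (simp add: T_def c.sum cross_mult_right Cross3.right_diff_distrib scaleR_diff_right
            sum_negf[symmetric])
  qed
  have "T = 0" if "cross3 (N i) T = 0" "N i \<bullet> T = 0"
    using norm_and_cross_eq_0[of "N i" T] that assms by auto
  then show ?thesis unfolding H F T_def[symmetric] by auto
qed

section \<open>Equilibrium and vanishing mean curvature\<close>

text \<open>
  Once a primitive exists the forces balance automatically, so only the component of the torque
  along the normal is left, which is the mean curvature.
\<close>

lemma C_minimal_iff_torques:
  assumes M: "triangulated_surface M" and adm: "admissible M N" and nd: "nondegenerate M N"
    and df: "\<And>i j. {i, j} \<in> interior_edges M \<Longrightarrow> dual_diff M f i j = k {i, j} *\<^sub>R cross3 (N i) (N j)"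
  shows "C_minimal M f N \<longleftrightarrow>
    (\<forall>i\<in>interior_verts M. torques_balanced M (edge_point N) (\<lambda>i j. k {i, j} *\<^sub>R cross3 (N i) (N j)) i)"
proof -
  have unit: "norm (N i) = 1" if "i \<in> verts M" for i
    using adm that by (simp add: admissible_def)
  have edge: "norm (N i) = 1" "norm (N j) = 1" "N i \<noteq> N j" "N i \<noteq> - N j" if "{i, j} \<in> edges M" for i j
    using unit edge_ends_in_verts[OF M that] adm nd that
    by (simp_all add: admissible_def nondegenerate_def)
  have planar: "planar_faces_with_normal M f N"
    using df by (simp add: planar_faces_with_normal_def dot_cross_self)
  have H: "mean_curvature M N f i = 0 \<longleftrightarrow>
      torques_balanced M (edge_point N) (\<lambda>i j. k {i, j} *\<^sub>R cross3 (N i) (N j)) i"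
    if i: "i \<in> interior_verts M" for i
  proof -
    have "mean_curvature M N f i = (\<Sum>j\<in>neighbors M i. k {i, j} * (1 - N i \<bullet> N j))"
      unfolding mean_curvature_def
    proof (rule sum.cong[OF refl])
      fix j assume j: "j \<in> neighbors M i"
      then have "{i, j} \<in> edges M" by (simp add: neighbors_def)
      from norm_times_tan_dihedral_angle[OF edge[OF this] df[OF interior_vertex_edge[OF i j]]]
      show "(if dual_diff M f i j = 0 then 0
          else norm (dual_diff M f i j) * tan (dihedral_angle M N f i j / 2))
         = k {i, j} * (1 - N i \<bullet> N j)" .
    qed
    moreover have "(\<Sum>j\<in>neighbors M i. k {i, j} *\<^sub>R cross3 (N i) (N j)) = 0"
      using sum_dual_diff_interior_vertex[OF M i, of f] df[OF interior_vertex_edge[OF i]] by simp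
    moreover have "(\<Sum>j\<in>neighbors M i. cross3 (edge_point N i j) (k {i, j} *\<^sub>R cross3 (N i) (N j)))
        = (\<Sum>j\<in>neighbors M i. k {i, j} *\<^sub>R (N i - N j))"
    proof (rule sum.cong[OF refl])
      fix j assume "j \<in> neighbors M i"
      then have "{i, j} \<in> edges M" by (simp add: neighbors_def)
      from edge_point_torque[of N i j "k {i, j}", OF edge(1,2,4)[OF this]]
      show "cross3 (edge_point N i j) (k {i, j} *\<^sub>R cross3 (N i) (N j)) = k {i, j} *\<^sub>R (N i - N j)" .
    qed
    moreover have "norm (N i) = 1" using unit i by (simp add: interior_verts_def)
    ultimately show ?thesis
      using torque_zero_iff[of N i "\<lambda>j. k {i, j}" "neighbors M i"] by (simp add: torques_balanced_def)
  qed
  show ?thesis unfolding C_minimal_def using adm planar H by blast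
qed

theorem proposition5:
  fixes M :: "'v tri_surface"
    and N :: "'v \<Rightarrow> real^3"
    and Nhat :: "'v set \<Rightarrow> real^3"
    and k :: "'v set \<Rightarrow> real"
  assumes "triangulated_surface M"
    and "simply_connected_surface M"
    and "admissible M N"
    and "is_polar M N Nhat"
    and "nondegenerate M N"
    and "dual_nondegenerate M Nhat"
  shows "((\<exists>f. C_minimal M f N \<and>
             (\<forall>i j. {i, j} \<in> interior_edges M \<longrightarrow>
                dual_diff M f i j = k {i, j} *\<^sub>R cross3 (N i) (N j)))
          \<longleftrightarrow>
          (equal_and_opposite M (\<lambda>i j. k {i, j} *\<^sub>R cross3 (N i) (N j)) \<and>
           (\<forall>i\<in>interior_verts M.
              forces_balanced M (\<lambda>i j. k {i, j} *\<^sub>R cross3 (N i) (N j)) i \<and>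
              torques_balanced M (edge_point N) (\<lambda>i j. k {i, j} *\<^sub>R cross3 (N i) (N j)) i)))
         \<and>
         (\<forall>i j. {i, j} \<in> interior_edges M \<longrightarrow>
            edge_point N i j \<in> affine hull {Nhat (left_face M i j), Nhat (right_face M i j)})"
proof -
  note M = assms(1)
  let ?F = "\<lambda>i j. k {i, j} *\<^sub>R cross3 (N i) (N j)"
  have skew: "?F j i = - ?F i j" for i j
    using cross_skew[of "N j" "N i"] by (simp add: insert_commute)
  have "(\<exists>f. C_minimal M f N \<and> (\<forall>i j. {i, j} \<in> interior_edges M \<longrightarrow> dual_diff M f i j = ?F i j))
    \<longleftrightarrow> equal_and_opposite M ?F \<and>
        (\<forall>i\<in>interior_verts M. forces_balanced M ?F i \<and> torques_balanced M (edge_point N) ?F i)"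
    (is "?L \<longleftrightarrow> ?R")
  proof
    assume ?L
    then obtain f where f: "C_minimal M f N"
      and df: "\<And>i j. {i, j} \<in> interior_edges M \<Longrightarrow> dual_diff M f i j = ?F i j" by blast
    have "forces_balanced M ?F i" if "i \<in> interior_verts M" for i
      using sum_dual_diff_interior_vertex[OF M that, of f] df[OF interior_vertex_edge[OF that]]
      by (simp add: forces_balanced_def)
    moreover have "equal_and_opposite M ?F"
      unfolding equal_and_opposite_def using skew by blast
    ultimately show ?R
      using C_minimal_iff_torques[OF M assms(3,5) df] f by blast
  next
    assume R: ?R
    have "\<exists>f. \<forall>i j. {i, j} \<in> interior_edges M \<longrightarrow> dual_diff M f i j = ?F i j"
    proof (rule dual_closed_imp_exact[OF M assms(2), of ?F])
      show "?F j i = - ?F i j" for i j by (rule skew)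
      show "(\<Sum>j\<in>neighbors M i. ?F i j) = 0" if "i \<in> interior_verts M" for i
        using R that by (simp add: forces_balanced_def)
    qed (auto simp: dual_diff_def)
    then obtain f where df: "\<And>i j. {i, j} \<in> interior_edges M \<Longrightarrow> dual_diff M f i j = ?F i j"
      by blast
    then show ?L using C_minimal_iff_torques[OF M assms(3,5) df] R by blast
  qed
  moreover have "edge_point N i j \<in> affine hull {Nhat (left_face M i j), Nhat (right_face M i j)}"
    if e: "{i, j} \<in> interior_edges M" for i j
  proof (rule edge_point_on_polar_line)
    have ij: "{i, j} \<in> edges M" using e by (simp add: interior_edges_def)
    show "norm (N i) = 1" "norm (N j) = 1" "N i \<noteq> N j" "N i \<noteq> - N j"
      using edge_ends_in_verts[OF M ij] assms(3,5) ij by (simp_all add: admissible_def nondegenerate_def)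
    show "Nhat (left_face M i j) \<noteq> Nhat (right_face M i j)"
      using assms(6) e by (simp add: dual_nondegenerate_def)
    show "N i \<bullet> Nhat (left_face M i j) = 1" "N j \<bullet> Nhat (left_face M i j) = 1"
      "N i \<bullet> Nhat (right_face M i j) = 1" "N j \<bullet> Nhat (right_face M i j) = 1"
      using assms(4) face_sides[OF M e] by (auto simp: is_polar_def polar_plane_def)
  qed
  ultimately show ?thesis by blast
qed

end
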